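(* Let $V$ be a space containing a rational $4$-tuple. Then $V$ is homothetic either to a superrectangular space, or to one of the two dodecagonal spaces $\mathbb{Q}+\mathbb{Q}\tau_1$, $\mathbb{Q}+\mathbb{Q}\tau_2$, where $\tau_1=(i+1)\frac{\sqrt{3}-1}{2}$ and $\tau_2=(i-1)\frac{3-\sqrt{3}}{2}$.
   Context: A space is a $2$-dimensional $\mathbb{Q}$-vector subspace $V\subset\mathbb{C}$ containing two $\mathbb{R}$-linearly independent vectors. Spaces $V_1,V_2$ are homothetic if $V_2=\lambda V_1$ for some $\lambda\in\mathbb{C}^*$. A rational $4$-tuple in $V$ is a set of $4$ vectors of $V$ spanning $4$ distinct lines through $0$ such that for any two of them $v,w$ the argument of $w/v$ is a rational multiple of $\pi$. $V$ is superrectangular if it is homothetic to $\mathbb{Q}+\mathbb{Q}\tau$ for some root of unity $\tau$. *)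

theory Defs
  imports "HOL-Analysis.Analysis"
begin

definition qspan2 :: "complex \<Rightarrow> complex \<Rightarrow> complex set" where
  "qspan2 a b = {of_real (of_rat p) * a + of_real (of_rat q) * b | p q. True}"

definition q_indep :: "complex \<Rightarrow> complex \<Rightarrow> bool" where
  "q_indep a b \<longleftrightarrow> (\<forall>p q::rat. of_real (of_rat p) * a + of_real (of_rat q) * b = 0 \<longrightarrow> p = 0 \<and> q = 0)"

definition r_indep :: "complex \<Rightarrow> complex \<Rightarrow> bool" where
  "r_indep a b \<longleftrightarrow> (\<forall>s t::real. of_real s * a + of_real t * b = 0 \<longrightarrow> s = 0 \<and> t = 0)"

definition is_space :: "complex set \<Rightarrow> bool" where
  "is_space V \<longleftrightarrow> (\<exists>a b. q_indep a b \<and> V = qspan2 a b) \<and> (\<exists>u\<in>V. \<exists>v\<in>V. r_indep u v)"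

definition homothetic :: "complex set \<Rightarrow> complex set \<Rightarrow> bool" where
  "homothetic V1 V2 \<longleftrightarrow> (\<exists>c::complex. c \<noteq> 0 \<and> V2 = (\<lambda>z. c * z) ` V1)"

definition rational_4tuple :: "complex set \<Rightarrow> complex set \<Rightarrow> bool" where
  "rational_4tuple V T \<longleftrightarrow>
     T \<subseteq> V \<and> card T = 4 \<and> 0 \<notin> T \<and>
     card ((\<lambda>v. {of_real t * v | t. True}) ` T) = 4 \<and>
     (\<forall>v\<in>T. \<forall>w\<in>T. \<exists>r::rat. Arg (w / v) = of_rat r * pi)"

definition superrectangular :: "complex set \<Rightarrow> bool" where
  "superrectangular V \<longleftrightarrow> (\<exists>\<tau>::complex. (\<exists>n::nat. n > 0 \<and> \<tau> ^ n = 1) \<and> homothetic V (qspan2 1 \<tau>))"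

definition tau1 :: complex where
  "tau1 = (\<i> + 1) * of_real ((sqrt 3 - 1) / 2)"

definition tau2 :: complex where
  "tau2 = (\<i> - 1) * of_real ((3 - sqrt 3) / 2)"

end

theory Submission
  imports Defs
begin

text \<open>
  Up to homothety the space is \<open>\<rat> + \<rat>\<sigma>\<close> and, up to rational factors, the four vectors are
  \<open>1, \<sigma> + a\<^sub>0, \<sigma> + a\<^sub>1, \<sigma> + a\<^sub>2\<close> with
  distinct rational \<open>a\<^sub>i\<close>, where each \<open>m\<^sub>i = (\<sigma> + a\<^sub>i) / cnj (\<sigma> + a\<^sub>i)\<close> is a root of unity. The cross-ratio of the
  four lines is rational, and after division by a square root \<open>s\<close> of \<open>m\<^sub>0 m\<^sub>1 m\<^sub>2\<close> this becomes a rational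
  linear relation with coefficient sum zero between the three distinct cosines \<open>Re \<xi>\<^sub>i\<close>, \<open>\<xi>\<^sub>i = m\<^sub>i / s\<close>.
  Let \<open>N\<close> be the least common order of the \<open>\<xi>\<^sub>i\<close>. Conjugating the relation by the residues \<open>k\<close> coprime to \<open>N\<close> with \<open>k = 1\<close>
  modulo \<open>N/p\<close> (or \<open>N/4\<close>) and taking Fourier coefficients splits it into shorter relations.
  Three distinct points of the unit circle are not collinear, so the coefficient sum rules out
  everything except a pair of opposite cosines and the case \<open>N dvd 12\<close>, where the absolute
  values are \<open>0, 1/2, 1\<close>. Opposite cosines mean that two of the four lines are orthogonal, and reflecting a
  third vector in one of them exhibits a superrectangular space; the remaining case gives the
  dodecagonal spaces.
\<close>

section \<open>Conjugates of roots of unity\<close>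

definition ieval :: "complex \<Rightarrow> int poly \<Rightarrow> complex" where
  "ieval z P = poly (map_poly of_int P) z"

lemma ieval_pCons [simp]: "ieval z (pCons a P) = of_int a + z * ieval z P"
  by (cases "P = 0 \<and> a = 0") (auto simp: ieval_def map_poly_pCons)

lemma ieval_0 [simp]: "ieval z 0 = 0"
  by (simp add: ieval_def)

lemma ieval_1 [simp]: "ieval z 1 = 1"
  by (simp add: one_pCons)

lemma ieval_add [simp]: "ieval z (P + Q) = ieval z P + ieval z Q"
  by (induction P Q rule: poly_induct2) (auto simp: algebra_simps)

lemma ieval_minus [simp]: "ieval z (- P) = - ieval z P"
  by (induction P) (auto simp: algebra_simps)

lemma ieval_diff [simp]: "ieval z (P - Q) = ieval z P - ieval z Q"
  using ieval_add[of z P "- Q"] by (simp del: ieval_add)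

lemma ieval_smult [simp]: "ieval z (smult c P) = of_int c * ieval z P"
  by (induction P) (auto simp: algebra_simps)

lemma ieval_mult [simp]: "ieval z (P * Q) = ieval z P * ieval z Q"
  by (induction P) (auto simp: algebra_simps)

lemma ieval_power [simp]: "ieval z (P ^ n) = ieval z P ^ n"
  by (induction n) auto

lemma ieval_monom [simp]: "ieval z (monom c n) = of_int c * z ^ n"
  by (induction n) (auto simp: monom_0 monom_Suc)

lemma ieval_sum [simp]: "ieval z (sum f A) = (\<Sum>x\<in>A. ieval z (f x))"
  by (induction A rule: infinite_finite_induct) auto

lemma ieval_of_nat [simp]: "ieval z (of_nat n) = of_nat n"
  by (induction n) auto

lemma ieval_pcompose_monom [simp]: "ieval z (pcompose P (monom 1 k)) = ieval (z ^ k) P"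
  by (induction P) (auto simp: pcompose_pCons)

section \<open>The Frobenius congruence modulo a prime\<close>

lemma prime_dvd_power_add:
  fixes x y :: "'a :: comm_ring_1"
  assumes "prime p"
  shows "of_nat p dvd (x + y) ^ p - x ^ p - y ^ p"
proof -
  have p: "p > 0" using assms by (simp add: prime_gt_0_nat)
  have "(x + y) ^ p = (\<Sum>k\<le>p. of_nat (p choose k) * x ^ k * y ^ (p - k))"
    by (rule binomial_ring)
  also have "{..p} = insert 0 (insert p {1..<p})"
    using p by auto
  also have "(\<Sum>k\<in>\<dots>. of_nat (p choose k) * x ^ k * y ^ (p - k)) =
      y ^ p + x ^ p + (\<Sum>k=1..<p. of_nat (p choose k) * x ^ k * y ^ (p - k))"
    using p by simp
  finally have "(x + y) ^ p - x ^ p - y ^ p =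
      (\<Sum>k=1..<p. of_nat (p choose k) * x ^ k * y ^ (p - k))"
    by simp
  also have "of_nat p dvd \<dots>"
  proof (intro dvd_sum dvd_mult2)
    fix k assume "k \<in> {1..<p}"
    then have "p dvd (p choose k)"
      using assms by (intro dvd_choose_prime) auto
    then show "(of_nat p :: 'a) dvd of_nat (p choose k)"
      by (elim dvdE) simp
  qed
  finally show ?thesis .
qed

lemma fermat_int:
  assumes "prime p"
  shows "int p dvd a ^ p - a"
proof (induction a rule: int_induct[where k = 0])
  case base
  show ?case using prime_gt_0_nat[OF assms] by (simp add: power_0_left)
next
  case (step1 a)
  from dvd_add[OF step1(2) prime_dvd_power_add[OF assms, of a 1]]
  show ?case by (simp add: algebra_simps)
next
  case (step2 a)
  from dvd_diff[OF step2(2) prime_dvd_power_add[OF assms, of "a - 1" 1]]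
  show ?case by (simp add: algebra_simps)
qed

text \<open>Splitting off the constant term \<open>a\<close> reduces the claim to Fermat's
  congruence for \<open>a\<close>, additivity of the \<open>p\<close>-th power modulo
  \<open>p\<close>, and the induction hypothesis multiplied by \<open>X ^ p\<close>.\<close>

lemma frobenius_poly:
  fixes P :: "int poly"
  assumes "prime p"
  shows "of_nat p dvd P ^ p - pcompose P (monom 1 p)"
proof (induction P)
  case 0
  then show ?case using prime_gt_0_nat[OF assms] by (simp add: power_0_left)
next
  case (pCons a P)
  let ?X = "monom 1 1 :: int poly"
  have eq: "pCons a P = [:a:] + ?X * P"
    by (simp add: monom_Suc)
  obtain b where b: "a ^ p - a = int p * b"
    using fermat_int[OF assms] by (auto simp: dvd_def)
  have "[:a:] ^ p - [:a:] = of_nat p * [:b:]"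
    using b by (simp add: poly_const_pow of_nat_poly)
  then have 1: "of_nat p dvd [:a:] ^ p - [:a:]" by (metis dvd_triv_left)
  have 2: "of_nat p dvd pCons a P ^ p - [:a:] ^ p - (?X * P) ^ p"
    unfolding eq by (rule prime_dvd_power_add[OF assms])
  have "of_nat p dvd ?X ^ p * (P ^ p - pcompose P (monom 1 p))"
    using pCons by simp
  then have 3: "of_nat p dvd (?X * P) ^ p - monom 1 p * pcompose P (monom 1 p)"
    by (simp add: monom_power power_mult_distrib algebra_simps)
  have "pCons a P ^ p - pcompose (pCons a P) (monom 1 p) =
     (pCons a P ^ p - [:a:] ^ p - (?X * P) ^ p) + ([:a:] ^ p - [:a:])
     + ((?X * P) ^ p - monom 1 p * pcompose P (monom 1 p))"
    by (simp add: pcompose_pCons)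
  then show ?case using 1 2 3 by (metis dvd_add)
qed

text \<open>\<open>m\<close> is the primitive part of a nonzero integer polynomial of least degree
  vanishing at \<open>z\<close>. Pseudo-division by \<open>m\<close> leaves remainder zero, and the
  scalar it introduces cancels by Gauss's lemma because \<open>m\<close> is primitive.\<close>

lemma min_int_poly:
  assumes "P \<noteq> 0" "ieval z P = 0"
  obtains m where "m \<noteq> 0" "degree m > 0" "\<And>Q. ieval z Q = 0 \<longleftrightarrow> m dvd Q"
proof -
  define S where "S = {Q. Q \<noteq> 0 \<and> ieval z Q = 0}"
  obtain m0 where m0: "m0 \<in> S" "\<And>Q. Q \<in> S \<Longrightarrow> degree m0 \<le> degree Q"
    using assms ex_has_least_nat[of "\<lambda>Q. Q \<in> S" P degree] unfolding S_def by blast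
  define m where "m = primitive_part m0"
  have m0': "m0 \<noteq> 0" "ieval z m0 = 0" using m0(1) by (auto simp: S_def)
  have m1: "m0 = smult (content m0) m"
    by (simp add: m_def)
  have m: "m \<noteq> 0" "content m = 1" "ieval z m = 0" "degree m = degree m0"
  proof -
    show "m \<noteq> 0" using m0' by (simp add: m_def)
    show "content m = 1" using m0' by (simp add: m_def)
    show "degree m = degree m0" by (simp add: m_def)
    have "of_int (content m0) * ieval z m = 0"
      using m0'(2) by (subst (asm) m1) simp
    then show "ieval z m = 0" using m0' by simp
  qed
  have min: "degree m \<le> degree Q" if "Q \<noteq> 0" "ieval z Q = 0" for Q
    using m0(2)[of Q] that m(4) by (auto simp: S_def)
  have "m dvd Q" if Q: "ieval z Q = 0" for Q
  proof -
    from pseudo_mod(1)[OF m(1), of Q] obtain a q where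
      a: "a \<noteq> 0" "smult a Q = m * q + pseudo_mod Q m" by blast
    have "ieval z (pseudo_mod Q m) = 0"
      using arg_cong[OF a(2), of "ieval z"] Q m by simp
    then have "pseudo_mod Q m = 0"
      using min[of "pseudo_mod Q m"] pseudo_mod(2)[OF m(1), of Q] by fastforce
    then have eq: "smult a Q = m * q" using a by simp
    then have "normalize a * content Q = content q"
      using content_mult[of m q] m by (metis content_smult mult_1)
    then have "a dvd content q" by (metis dvd_triv_left normalize_dvd_iff)
    then have "[:a:] dvd q" by (simp add: const_poly_dvd_iff_dvd_content)
    then obtain r where "q = smult a r" by (auto simp: dvd_def)
    then have "smult a (Q - m * r) = 0" using eq by (simp add: smult_diff_right)
    then show "m dvd Q" using a(1) by simp
  qed
  moreover have "ieval z Q = 0" if "m dvd Q" for Q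
    using that m by auto
  moreover have "degree m > 0"
  proof (rule ccontr)
    assume "\<not> degree m > 0"
    then obtain c where "m = [:c:]" by (metis degree_eq_zeroE neq0_conv)
    then show False using m by auto
  qed
  ultimately show thesis using m that by blast
qed

text \<open>Modulo \<open>p\<close> the divisor keeps its positive degree, since its leading
  coefficient is a unit, while the dividend becomes a nonzero constant.\<close>

lemma const_plus_multiple_not_dvd:
  fixes m K :: "int poly"
  assumes p: "prime p" and lc: "lead_coeff m dvd 1" and deg: "degree m > 0"
    and "\<not> int p dvd c"
  shows "\<not> m dvd smult (int p) K - [:c:]"
proof
  assume "m dvd smult (int p) K - [:c:]"
  then obtain k where k: "smult (int p) K - [:c:] = m * k" by (auto simp: dvd_def)
  define J where "J = {j. \<not> int p dvd coeff k j}"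
  have fin: "finite J"
    by (rule finite_subset[of _ "{..degree k}"]) (auto simp: J_def not_le coeff_eq_0 intro: ccontr)
  show False
  proof (cases "J = {}")
    case True
    have "coeff (m * k) 0 = coeff m 0 * coeff k 0" by (simp add: coeff_mult)
    moreover have "int p dvd coeff k 0" using True by (auto simp: J_def)
    ultimately have "int p dvd coeff (m * k) 0" by simp
    then have "int p dvd int p * coeff K 0 - c" by (simp flip: k)
    then show False using assms(4) by (metis dvd_diff dvd_triv_left diff_diff_eq2 add_diff_cancel_left')
  next
    case False
    \<comment> \<open>\<open>j\<close> is the degree of \<open>k\<close> modulo \<open>p\<close>, so
      modulo \<open>p\<close> only the two leading terms contribute to the coefficient of
      \<open>m * k\<close> at \<open>degree m + j\<close>. That index is positive, where the
      dividend vanishes modulo \<open>p\<close>.\<close>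
    define j where "j = Max J"
    have j: "j \<in> J" using False fin by (simp add: j_def)
    have gt: "int p dvd coeff k i" if "i > j" for i
      using that fin Max_ge[of J i] unfolding j_def by (auto simp: J_def simp flip: not_le)
    have "coeff (m * k) (degree m + j) =
        (\<Sum>i\<le>degree m + j. coeff m i * coeff k (degree m + j - i))"
      by (simp add: coeff_mult)
    also have "\<dots> = lead_coeff m * coeff k j +
        (\<Sum>i\<in>{..degree m + j} - {degree m}. coeff m i * coeff k (degree m + j - i))"
      by (subst sum.remove[of _ "degree m"]) auto
    finally have 1: "coeff (m * k) (degree m + j) = \<dots>" .
    have 2: "int p dvd (\<Sum>i\<in>{..degree m + j} - {degree m}. coeff m i * coeff k (degree m + j - i))"
    proof (rule dvd_sum)
      fix i assume i: "i \<in> {..degree m + j} - {degree m}"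
      show "int p dvd coeff m i * coeff k (degree m + j - i)"
        using i gt[of "degree m + j - i"] by (cases "i < degree m") (auto simp: coeff_eq_0)
    qed
    have "int p dvd coeff (m * k) (degree m + j)"
      using deg by (simp flip: k add: coeff_pCons split: nat.split)
    then have "int p dvd lead_coeff m * coeff k j"
      using 1 2 by (simp add: dvd_add_left_iff)
    then have "int p dvd coeff k j"
      using lc p by (metis prime_dvd_mult_iff dvd_trans not_prime_unit prime_nat_int_transfer)
    then show False using j by (simp add: J_def)
  qed
qed

text \<open>This is Dedekind's argument for the irreducibility of cyclotomic polynomials. Differentiating
  \<open>X^n - 1 = m h\<close> bounds the primes that can divide \<open>h(z)\<close>, and \<open>h(z^p) = 0\<close> would force
  \<open>h(z)^p\<close> to be divisible by \<open>p\<close>.\<close>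

lemma root_of_unity_conj_prime:
  assumes zn: "z ^ n = 1" and n: "n > 0" and p: "prime p" "\<not> p dvd n" and G: "ieval z G = 0"
  shows "ieval (z ^ p) G = 0"
proof -
  define U :: "int poly" where "U = monom 1 n - 1"
  have "coeff U n = 1" using n by (simp add: U_def)
  then have U0: "U \<noteq> 0" by auto
  have "ieval z U = 0" using zn by (simp add: U_def)
  then obtain m where m: "m \<noteq> 0" "degree m > 0" "\<And>Q. ieval z Q = 0 \<longleftrightarrow> m dvd Q"
    using min_int_poly[OF U0] by blast
  then have "m dvd U" using \<open>ieval z U = 0\<close> by blast
  then obtain h where h: "U = m * h" by (auto simp: dvd_def)
  have "degree U = n"
    unfolding U_def using n by (intro antisym degree_le le_degree) (auto simp: coeff_pCons one_pCons split: nat.splits)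
  then have "lead_coeff m * lead_coeff h = 1"
    using \<open>coeff U n = 1\<close> h by (metis lead_coeff_mult)
  then have lc: "lead_coeff m dvd 1" by (metis dvd_triv_left)
  have mz: "ieval z m = 0" using m(3) by simp
  have "ieval (z ^ p) m = 0"
  proof (rule ccontr)
    assume neq: "ieval (z ^ p) m \<noteq> 0"
    have "(z ^ p) ^ n = 1" using zn by (metis mult.commute power_mult power_one)
    then have "ieval (z ^ p) U = 0" by (simp add: U_def)
    then have hz: "ieval (z ^ p) h = 0" using neq h by simp
    obtain g where "h ^ p - pcompose h (monom 1 p) = of_nat p * g"
      using frobenius_poly[OF p(1), of h] by (auto simp: dvd_def)
    from arg_cong[OF this, of "ieval z"] hz have 1: "ieval z h ^ p = of_nat p * ieval z g" by simp
    have "pderiv U = pderiv m * h + m * pderiv h"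
      by (simp add: h pderiv_mult algebra_simps)
    moreover have "pderiv U = monom (int n) (n - 1)"
      by (simp add: U_def pderiv_diff pderiv_monom)
    ultimately have "monom (int n) (n - 1) = pderiv m * h + m * pderiv h" by simp
    from arg_cong[OF this, of "ieval z"] mz
    have "of_nat n * z ^ (n - 1) = ieval z (pderiv m) * ieval z h" by simp
    then have "of_nat n * (z ^ (n - 1) * z) = z * ieval z (pderiv m) * ieval z h"
      by (metis mult.assoc mult.commute)
    moreover have "z ^ (n - 1) * z = 1" using zn n by (metis power_minus_mult)
    ultimately have "of_nat n = z * ieval z (pderiv m) * ieval z h" by (metis mult_1_right)
    then have "of_nat n ^ p = (z * ieval z (pderiv m)) ^ p * (of_nat p * ieval z g)"
      by (simp add: 1 power_mult_distrib)
    \<comment> \<open>This polynomial vanishes at \<open>z\<close>, yet modulo \<open>p\<close> it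
      is a nonzero constant, which no multiple of \<open>m\<close> can be.\<close>
    then have "ieval z (smult (int p) ((monom 1 1 * pderiv m) ^ p * g) - [:int n ^ p:]) = 0"
      by simp
    then have "m dvd smult (int p) ((monom 1 1 * pderiv m) ^ p * g) - [:int n ^ p:]"
      using m(3) by blast
    moreover have "\<not> int p dvd int n ^ p"
      using p by (metis int_dvd_int_iff of_nat_power prime_dvd_power)
    ultimately show False
      using const_plus_multiple_not_dvd[OF p(1) lc m(2)] by blast
  qed
  moreover have "m dvd G" using G m(3) by blast
  ultimately show ?thesis by auto
qed

text \<open>Induction over the prime factors of \<open>k\<close>, none of which divides
  \<open>n\<close>: each replaces \<open>z\<close> by \<open>z ^ p\<close>, which is again an
  \<open>n\<close>-th root of unity.\<close>

lemma root_of_unity_conj: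
  assumes "z ^ n = 1" "n > 0" "coprime k n" "ieval z G = 0"
  shows "ieval (z ^ k) G = 0"
proof (cases "k = 0")
  case True
  then have "n = 1" using assms by simp
  then show ?thesis using assms True by simp
next
  case False
  then have "k > 0" by simp
  from this assms show ?thesis
  proof (induction k arbitrary: z rule: prime_divisors_induct)
    case (unit x)
    then show ?case by simp
  next
    case (factor p k)
    have "ieval (z ^ p) G = 0"
      using factor by (intro root_of_unity_conj_prime[of z n])
        (auto simp: coprime_mult_left_iff dest: prime_imp_coprime coprime_common_divisor)
    moreover have "(z ^ p) ^ n = 1"
      using factor by (metis mult.commute power_mult power_one)
    ultimately have "ieval ((z ^ p) ^ k) G = 0"
      using factor by (intro factor.IH) auto
    then show ?case by (simp add: power_mult)
  qed auto
qed

section \<open>Conjugating rational relations between cosines\<close>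

lemma common_denominator:
  fixes c :: "'i \<Rightarrow> real"
  assumes "finite I" "\<And>i. i \<in> I \<Longrightarrow> c i \<in> \<rat>"
  obtains D :: int and b :: "'i \<Rightarrow> int" where "D \<noteq> 0" "\<And>i. i \<in> I \<Longrightarrow> of_int (b i) = of_int D * c i"
proof -
  have "\<exists>D b. D \<noteq> 0 \<and> (\<forall>i\<in>I. of_int (b i) = of_int D * c i)"
    using assms
  proof (induction I rule: finite_induct)
    case empty
    then show ?case by (intro exI[of _ 1]) auto
  next
    case (insert k I)
    then obtain D b where D: "D \<noteq> 0" "\<forall>i\<in>I. real_of_int (b i) = of_int D * c i" by auto
    obtain x y :: int where xy: "c k = of_int x / of_int y" "y \<noteq> 0"
      using insert.prems[of k] by (auto elim!: Rats_cases')
    show ?case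
      using D xy insert.hyps
      by (intro exI[of _ "D * y"] exI[of _ "\<lambda>i. if i = k then D * x else b i * y"]) auto
  qed
  then show thesis using that by blast
qed

lemma root_of_unity_norm:
  fixes z :: complex
  assumes "z ^ n = 1" "n > 0"
  shows "norm z = 1"
  using assms by (metis norm_power norm_one norm_ge_zero power_eq_1_iff neq0_conv)

lemma unit_mult_cnj:
  assumes "norm z = 1"
  shows "z * cnj z = 1" "cnj z * z = 1"
  using assms complex_norm_square[of z] by (simp_all add: mult.commute)

text \<open>All \<open>\<xi> i\<close> are powers of one primitive \<open>N\<close>-th root of unity
  \<open>\<zeta>\<close>, and \<open>2 * Re x = x + x ^ (N - 1)\<close> for an \<open>N\<close>-th
  root of unity \<open>x\<close>. After clearing denominators the relation says that an integer
  polynomial \<open>G\<close> vanishes at \<open>\<zeta>\<close>, hence also at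
  \<open>\<zeta> ^ k\<close>.\<close>

lemma sum_Re_conj:
  fixes \<xi> :: "'i \<Rightarrow> complex" and c :: "'i \<Rightarrow> real"
  assumes fin: "finite I" and N: "N > 0" and root: "\<And>i. i \<in> I \<Longrightarrow> \<xi> i ^ N = 1"
    and rat: "\<And>i. i \<in> I \<Longrightarrow> c i \<in> \<rat>"
    and rel: "(\<Sum>i\<in>I. c i * Re (\<xi> i)) = 0" and cop: "coprime k N"
  shows "(\<Sum>i\<in>I. c i * Re (\<xi> i ^ k)) = 0"
proof -
  define \<zeta> where "\<zeta> = cis (2 * pi / real N)"
  have \<zeta>N: "\<zeta> ^ N = 1" using N by (simp add: \<zeta>_def Complex.DeMoivre cis_2pi)
  have "\<exists>e. \<xi> i = \<zeta> ^ e" if "i \<in> I" for i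
  proof -
    have "\<xi> i \<in> {z. z ^ N = 1}" using root that by simp
    then obtain e where "\<xi> i = cis (2 * pi * real e / real N)"
      using Complex.bij_betw_roots_unity[OF N] by (auto simp: bij_betw_def)
    then show ?thesis by (auto simp: \<zeta>_def Complex.DeMoivre algebra_simps)
  qed
  then obtain e where e: "\<And>i. i \<in> I \<Longrightarrow> \<xi> i = \<zeta> ^ e i" by metis
  obtain D :: int and b :: "'i \<Rightarrow> int"
    where D: "D \<noteq> 0" "\<And>i. i \<in> I \<Longrightarrow> of_int (b i) = of_int D * c i"
    using common_denominator[OF fin, of c] rat by blast
  define G where "G = (\<Sum>i\<in>I. monom (b i) (e i) + monom (b i) (e i * (N - 1)))"
  have G: "ieval (\<zeta> ^ l) G = of_real (2 * of_int D * (\<Sum>i\<in>I. c i * Re (\<xi> i ^ l)))" for l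
  proof -
    have "of_int (b i) * (\<zeta> ^ l) ^ e i + of_int (b i) * (\<zeta> ^ l) ^ (e i * (N - 1))
        = complex_of_real (2 * of_int D * (c i * Re (\<xi> i ^ l)))" if i: "i \<in> I" for i
    proof -
      let ?w = "\<xi> i ^ l"
      have w: "(\<zeta> ^ l) ^ e i = ?w" using e[OF i] by (simp add: mult.commute flip: power_mult)
      have wN: "?w ^ N = 1" using root[OF i] by (metis mult.commute power_mult power_one)
      have "cnj ?w = cnj ?w * (?w ^ (N - 1) * ?w)"
        using wN N by (metis power_minus_mult mult_1_right)
      also have "\<dots> = ?w ^ (N - 1) * (cnj ?w * ?w)" by (simp only: ac_simps)
      finally have "?w ^ (N - 1) = cnj ?w"
        using unit_mult_cnj(2)[OF root_of_unity_norm[OF wN N]] by (metis mult_1_right)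
      then have "of_int (b i) * (\<zeta> ^ l) ^ e i + of_int (b i) * (\<zeta> ^ l) ^ (e i * (N - 1))
        = of_int (b i) * (?w + cnj ?w)"
        by (simp only: power_mult w distrib_left)
      also have "\<dots> = of_int (b i) * of_real (2 * Re ?w)"
        by (simp only: complex_add_cnj of_real_mult of_real_numeral)
      also have "\<dots> = of_real (of_int (b i) * (2 * Re ?w))"
        by (simp only: of_real_mult of_real_of_int_eq)
      finally show ?thesis using D(2)[OF i] by (simp only: ac_simps)
    qed
    then show ?thesis by (simp add: G_def sum_distrib_left)
  qed
  have "ieval (\<zeta> ^ 1) G = 0" unfolding G using rel by simp
  then have "ieval (\<zeta> ^ k) G = 0"
    using root_of_unity_conj[OF \<zeta>N N cop] by simp
  then show ?thesis unfolding G of_real_eq_0_iff using D(1) by simp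
qed

section \<open>Fourier classes of a relation between cosines\<close>

lemma sum_powers_root_of_unity:
  fixes z :: complex
  assumes "z ^ d = 1"
  shows "(\<Sum>j<d. z ^ j) = (if z = 1 then of_nat d else 0)"
  using assms by (auto simp: sum_gp_strict)

text \<open>In \<open>2 * c * Re \<xi> = c * \<xi> + c * cnj \<xi>\<close> the first half carries
  the label \<open>w i\<close> and the second the label \<open>cnj (w i)\<close>; all halves
  labelled \<open>\<omega>\<close> are collected. If \<open>w i\<close> is real, both halves fall
  into the same class.\<close>

definition fourier_class :: "'i set \<Rightarrow> ('i \<Rightarrow> real) \<Rightarrow> ('i \<Rightarrow> complex) \<Rightarrow> ('i \<Rightarrow> complex) \<Rightarrow> complex \<Rightarrow> complex" where
  "fourier_class I c \<xi> w \<omega> =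
     (\<Sum>i\<in>I. (if w i = \<omega> then of_real (c i) * \<xi> i else 0)
          + (if cnj (w i) = \<omega> then of_real (c i) * cnj (\<xi> i) else 0))"

text \<open>Twice the \<open>j\<close>-th sum equals the sum over \<open>\<omega>\<close> of the
  class of \<open>\<omega>\<close> times \<open>\<omega> ^ j\<close>. Fourier inversion recovers
  each class from the sums, and only the index \<open>j0\<close> contributes.\<close>

lemma fourier_class_eq:
  fixes \<xi> w :: "'i \<Rightarrow> complex"
  assumes w: "\<And>i. i \<in> I \<Longrightarrow> w i ^ d = 1" and \<omega>: "\<omega> ^ d = 1" and "j0 < d"
    and G0: "\<And>j. j < d \<Longrightarrow> j \<noteq> j0 \<Longrightarrow> (\<Sum>i\<in>I. c i * Re (\<xi> i * w i ^ j)) = 0"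
  shows "of_nat d * fourier_class I c \<xi> w \<omega> =
    of_real (2 * (\<Sum>i\<in>I. c i * Re (\<xi> i * w i ^ j0))) * cnj \<omega> ^ j0"
proof -
  have d: "d > 0" using \<open>j0 < d\<close> by simp
  have \<omega>1: "\<omega> * cnj \<omega> = 1" using root_of_unity_norm[OF \<omega> d] by (rule unit_mult_cnj)
  \<comment> \<open>Orthogonality of characters: summing over \<open>j\<close> selects the label
    \<open>\<omega>\<close>.\<close>
  have dft: "(\<Sum>j<d. v ^ j * cnj \<omega> ^ j) = (if v = \<omega> then of_nat d else 0)" if v: "v ^ d = 1" for v
  proof -
    have "v * cnj \<omega> = 1 \<longleftrightarrow> v = \<omega>"
    proof
      assume "v * cnj \<omega> = 1"
      then have "v * (\<omega> * cnj \<omega>) = \<omega>" by (simp add: ac_simps)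
      then show "v = \<omega>" using \<omega>1 by simp
    qed (use \<omega>1 in simp)
    moreover have "(v * cnj \<omega>) ^ d = 1"
      using v \<omega> by (metis power_mult_distrib complex_cnj_power complex_cnj_one mult_1)
    ultimately show ?thesis
      using sum_powers_root_of_unity[of "v * cnj \<omega>" d] by (simp add: power_mult_distrib)
  qed
  have "of_real (2 * (\<Sum>i\<in>I. c i * Re (\<xi> i * w i ^ j0))) * cnj \<omega> ^ j0
     = (\<Sum>j<d. of_real (2 * (\<Sum>i\<in>I. c i * Re (\<xi> i * w i ^ j))) * cnj \<omega> ^ j)"
    using \<open>j0 < d\<close> G0 by (subst sum.remove[of _ j0]) (auto intro!: sum.neutral)
  also have "\<dots> = (\<Sum>j<d. \<Sum>i\<in>I. of_real (c i) * \<xi> i * (w i ^ j * cnj \<omega> ^ j)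
       + of_real (c i) * cnj (\<xi> i) * (cnj (w i) ^ j * cnj \<omega> ^ j))"
  proof (intro sum.cong refl)
    fix j
    have "complex_of_real (2 * (\<Sum>i\<in>I. c i * Re (\<xi> i * w i ^ j)))
        = (\<Sum>i\<in>I. of_real (c i) * (\<xi> i * w i ^ j + cnj (\<xi> i * w i ^ j)))"
      by (subst complex_add_cnj) (simp add: sum_distrib_left ac_simps)
    then show "of_real (2 * (\<Sum>i\<in>I. c i * Re (\<xi> i * w i ^ j))) * cnj \<omega> ^ j =
       (\<Sum>i\<in>I. of_real (c i) * \<xi> i * (w i ^ j * cnj \<omega> ^ j)
       + of_real (c i) * cnj (\<xi> i) * (cnj (w i) ^ j * cnj \<omega> ^ j))"
      by (simp only: sum_distrib_right complex_cnj_mult complex_cnj_power distrib_left distrib_right)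
        (simp only: ac_simps)
  qed
  also have "\<dots> = (\<Sum>i\<in>I. of_real (c i) * \<xi> i * (\<Sum>j<d. w i ^ j * cnj \<omega> ^ j)
       + of_real (c i) * cnj (\<xi> i) * (\<Sum>j<d. cnj (w i) ^ j * cnj \<omega> ^ j))"
    by (subst sum.swap) (simp add: sum.distrib sum_distrib_left)
  also have "\<dots> = (\<Sum>i\<in>I. of_nat d * ((if w i = \<omega> then of_real (c i) * \<xi> i else 0)
          + (if cnj (w i) = \<omega> then of_real (c i) * cnj (\<xi> i) else 0)))"
  proof (intro sum.cong refl)
    fix i assume "i \<in> I"
    then have "w i ^ d = 1" "cnj (w i) ^ d = 1" using w by (auto simp flip: complex_cnj_power)
    then show "of_real (c i) * \<xi> i * (\<Sum>j<d. w i ^ j * cnj \<omega> ^ j)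
       + of_real (c i) * cnj (\<xi> i) * (\<Sum>j<d. cnj (w i) ^ j * cnj \<omega> ^ j) =
      of_nat d * ((if w i = \<omega> then of_real (c i) * \<xi> i else 0)
          + (if cnj (w i) = \<omega> then of_real (c i) * cnj (\<xi> i) else 0))"
      by (simp only: dft) (auto simp: algebra_simps)
  qed
  finally show ?thesis by (simp add: fourier_class_def sum_distrib_left)
qed

section \<open>Short linear relations between points of the unit circle\<close>

lemma unit_two_term:
  assumes "norm x = 1" "norm y = 1" "of_real a * x + of_real b * y = 0" "a \<noteq> 0"
  shows "x = y \<or> x = - (y::complex)"
proof -
  have eq: "of_real a * x = - (of_real b * y)" using assms(3) by (simp add: eq_neg_iff_add_eq_0)
  from arg_cong[OF this, of norm] have "\<bar>a\<bar> = \<bar>b\<bar>" using assms by (simp add: norm_mult)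
  then consider "b = a" | "b = - a" by linarith
  then show ?thesis
  proof cases
    case 1
    then have "of_real a * (x + y) = 0" using assms(3) by (simp add: algebra_simps)
    then show ?thesis using assms(4) by (simp add: eq_neg_iff_add_eq_0)
  next
    case 2
    then have "of_real a * (x - y) = 0" using assms(3) by (simp add: algebra_simps)
    then show ?thesis using assms(4) by simp
  qed
qed

text \<open>Eliminating \<open>c\<close> and comparing squared norms shows that the inner product of
  \<open>x\<close> and \<open>y\<close> is 1. Geometrically, a line cannot meet the circle in three
  distinct points.\<close>

lemma unit_collinear:
  assumes n: "norm x = 1" "norm y = 1" "norm z = 1"
    and rel: "of_real a * x + of_real b * y + of_real c * z = (0::complex)"
    and s: "a + b + c = 0" and nz: "a \<noteq> 0" "b \<noteq> 0"
  shows "x = y"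
proof -
  obtain x1 x2 y1 y2 z1 z2 where xyz: "x = Complex x1 x2" "y = Complex y1 y2" "z = Complex z1 z2"
    by (metis complex.exhaust)
  have n': "x1\<^sup>2 + x2\<^sup>2 = 1" "y1\<^sup>2 + y2\<^sup>2 = 1" "z1\<^sup>2 + z2\<^sup>2 = 1"
    using n by (simp_all add: xyz cmod_def)
  have c: "c = - (a + b)" using s by simp
  have "a * x1 + b * y1 = (a + b) * z1" "a * x2 + b * y2 = (a + b) * z2"
    using rel by (simp_all add: xyz complex_eq_iff c algebra_simps)
  then have "(a * x1 + b * y1)\<^sup>2 + (a * x2 + b * y2)\<^sup>2 = (a + b)\<^sup>2 * (z1\<^sup>2 + z2\<^sup>2)"
    by (simp only: power_mult_distrib distrib_left)
  moreover have "(a * x1 + b * y1)\<^sup>2 + (a * x2 + b * y2)\<^sup>2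
      = a\<^sup>2 * (x1\<^sup>2 + x2\<^sup>2) + b\<^sup>2 * (y1\<^sup>2 + y2\<^sup>2) + 2 * (a * b) * (x1 * y1 + x2 * y2)"
    by (simp add: power2_eq_square algebra_simps)
  ultimately have "a\<^sup>2 + b\<^sup>2 + 2 * (a * b) * (x1 * y1 + x2 * y2) = (a + b)\<^sup>2"
    unfolding n' by simp
  then have "2 * (a * b) * (x1 * y1 + x2 * y2 - 1) = 0"
    by (simp add: power2_eq_square algebra_simps)
  then have "x1 * y1 + x2 * y2 = 1" using nz by simp
  moreover have "(x1 - y1)\<^sup>2 + (x2 - y2)\<^sup>2
      = (x1\<^sup>2 + x2\<^sup>2) + (y1\<^sup>2 + y2\<^sup>2) - 2 * (x1 * y1 + x2 * y2)"
    by (simp add: power2_eq_square algebra_simps)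
  ultimately have "(x1 - y1)\<^sup>2 + (x2 - y2)\<^sup>2 = 0" unfolding n' by simp
  then show ?thesis by (simp add: xyz sum_power2_eq_zero_iff)
qed

text \<open>Since \<open>w k\<close> is not real, each index contributes at most one half to its
  class. A single term cannot vanish, three terms contradict \<open>unit_collinear\<close>, and two
  terms are equal or opposite; equality is excluded by injectivity of the cosines.\<close>

lemma vanishing_class_opposite:
  fixes \<xi> w :: "'i \<Rightarrow> complex" and c :: "'i \<Rightarrow> real"
  assumes card: "card I = 3" and n: "\<And>i. i \<in> I \<Longrightarrow> norm (\<xi> i) = 1"
    and c: "(\<Sum>i\<in>I. c i) = 0" "\<And>i. i \<in> I \<Longrightarrow> c i \<noteq> 0"
    and inj: "inj_on (\<lambda>i. Re (\<xi> i)) I"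
    and k: "k \<in> I" "cnj (w k) \<noteq> w k" and cls: "fourier_class I c \<xi> w (w k) = 0"
  shows "\<exists>i\<in>I. \<exists>j\<in>I. i \<noteq> j \<and> Re (\<xi> i) = - Re (\<xi> j)"
proof -
  have fin: "finite I" using card by (metis card.infinite zero_neq_numeral)
  \<comment> \<open>For an index in the class, \<open>x i\<close> is the half of the pair
    \<open>\<xi> i\<close>, \<open>cnj (\<xi> i)\<close> that lies in it. Conjugation keeps the real
    part, so the \<open>x i\<close> remain distinct.\<close>
  define x where "x i = (if w i = w k then \<xi> i else cnj (\<xi> i))" for i
  define J where "J = {i\<in>I. w i = w k \<or> cnj (w i) = w k}"
  have J: "finite J" "k \<in> J" "J \<subseteq> I" using fin k by (auto simp: J_def)
  have nx: "norm (x i) = 1" if "i \<in> I" for i using n[OF that] by (simp add: x_def)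
  have Re_x: "Re (x i) = Re (\<xi> i)" for i by (simp add: x_def)
  have neq: "x i \<noteq> x j" if "i \<in> I" "j \<in> I" "i \<noteq> j" for i j
    using inj that Re_x by (metis inj_onD)
  have "fourier_class I c \<xi> w (w k) = (\<Sum>i\<in>J. of_real (c i) * x i)"
    unfolding fourier_class_def J_def using fin
  proof (subst sum.inter_filter, simp, intro sum.cong refl)
    fix i
    have "\<not> (w i = w k \<and> cnj (w i) = w k)" using k by metis
    then show "(if w i = w k then of_real (c i) * \<xi> i else 0) +
         (if cnj (w i) = w k then of_real (c i) * cnj (\<xi> i) else 0) =
         (if w i = w k \<or> cnj (w i) = w k then of_real (c i) * x i else 0)"
      by (auto simp: x_def)
  qed
  then have rel: "(\<Sum>i\<in>J. of_real (c i) * x i) = 0" using cls by simp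
  have "card J \<le> 3" using J(3) fin card card_mono by metis
  moreover have "card J \<noteq> 0" using J by auto
  ultimately consider "card J = 1" | "card J = 2" | "card J = 3" by linarith
  then show ?thesis
  proof cases
    case 1
    then have "J = {k}" using J(2) by (metis card_1_singletonE singletonD)
    then have "of_real (c k) * x k = 0" using rel by simp
    then show ?thesis using c(2) nx k(1) by fastforce
  next
    case 2
    then obtain i j where ij: "J = {i, j}" "i \<noteq> j" by (auto simp: card_2_iff)
    then have I: "i \<in> I" "j \<in> I" using J by auto
    have "of_real (c i) * x i + of_real (c j) * x j = 0" using rel ij by simp
    then have "x i = - x j" using unit_two_term[of "x i" "x j"] nx c(2) neq ij I by metis
    then have "Re (\<xi> i) = - Re (\<xi> j)" using Re_x by (metis uminus_complex.sel(1))
    then show ?thesis using I ij by blast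
  next
    case 3
    then have "J = I" using J fin card by (metis card_subset_eq)
    obtain i j l where ijl: "I = {i, j, l}" "i \<noteq> j" "j \<noteq> l" "i \<noteq> l" using card by (auto simp: card_3_iff)
    have "of_real (c i) * x i + of_real (c j) * x j + of_real (c l) * x l = 0"
      using rel \<open>J = I\<close> ijl by (simp add: add.assoc)
    moreover have "c i + c j + c l = 0" using c(1) ijl by (simp add: add.assoc)
    ultimately have "x i = x j" using nx c(2) ijl unit_collinear[of "x i" "x j" "x l"] by blast
    then show ?thesis using neq ijl by blast
  qed
qed

section \<open>Rational relations between three cosines\<close>

lemma common_prime_factor:
  fixes a b :: nat
  assumes "\<not> coprime a b"
  shows "\<exists>q. prime q \<and> q dvd a \<and> q dvd b"
proof -
  have "gcd a b \<noteq> 1" using assms by (simp add: coprime_iff_gcd_eq_1)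
  then obtain q where "prime q" "q dvd gcd a b" using prime_factor_nat by blast
  then show ?thesis by auto
qed

lemma coprime_1_plus:
  assumes "\<And>q. prime q \<Longrightarrow> q dvd N \<Longrightarrow> q dvd M" "N > (0::nat)"
  shows "coprime (1 + j * M) N"
proof (rule ccontr)
  assume "\<not> coprime (1 + j * M) N"
  then obtain q where "prime q" "q dvd 1 + j * M" "q dvd N"
    using common_prime_factor by blast
  then have "q dvd 1" using assms(1)[of q] by (metis dvd_add_left_iff dvd_mult)
  then show False using \<open>prime q\<close> not_prime_unit by blast
qed

text \<open>The relation in the case where no two cosines are opposite; the aim is to force the
  absolute values 0, 1/2, 1.\<close>

locale cosine_relation =
  fixes I :: "'i set" and \<xi> :: "'i \<Rightarrow> complex" and c :: "'i \<Rightarrow> real"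
  assumes card_I: "card I = 3"
    and rat: "i \<in> I \<Longrightarrow> c i \<in> \<rat>" and nz: "i \<in> I \<Longrightarrow> c i \<noteq> 0"
    and sum_c: "(\<Sum>i\<in>I. c i) = 0"
    and rel: "(\<Sum>i\<in>I. c i * Re (\<xi> i)) = 0"
    and inj: "inj_on (\<lambda>i. Re (\<xi> i)) I"
    and no_opposite: "\<lbrakk>i \<in> I; j \<in> I; i \<noteq> j\<rbrakk> \<Longrightarrow> Re (\<xi> i) \<noteq> - Re (\<xi> j)"
begin

lemma finite_I: "finite I"
  using card_I by (metis card.infinite zero_neq_numeral)

lemma coprime_conj:
  assumes "N > 0" "\<And>i. i \<in> I \<Longrightarrow> \<xi> i ^ N = 1" "coprime k N"
  shows "(\<Sum>i\<in>I. c i * Re (\<xi> i ^ k)) = 0"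
  using sum_Re_conj[OF finite_I assms(1,2) rat rel assms(3)] by blast

lemma class_nonzero:
  assumes "N > 0" "\<And>i. i \<in> I \<Longrightarrow> \<xi> i ^ N = 1" "k \<in> I" "w k \<noteq> cnj (w k)"
  shows "fourier_class I c \<xi> w (w k) \<noteq> 0"
  using vanishing_class_opposite[of I \<xi> c k w] assms card_I nz sum_c inj no_opposite
    root_of_unity_norm by metis

text \<open>Every one of the \<open>d\<close> conjugated sums vanishes, hence so do all Fourier
  classes. By \<open>class_nonzero\<close> the label \<open>\<xi> k ^ M\<close> must then be real,
  so its square is 1.\<close>

lemma power_eq_1_if_all_coprime:
  assumes N: "N = d * M" "N > 0" "\<And>i. i \<in> I \<Longrightarrow> \<xi> i ^ N = 1"
    and cop: "\<And>j. j < d \<Longrightarrow> coprime (1 + j * M) N" and k: "k \<in> I"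
  shows "\<xi> k ^ (2 * M) = 1"
proof (rule ccontr)
  assume neq: "\<xi> k ^ (2 * M) \<noteq> 1"
  define w where "w = (\<lambda>i. \<xi> i ^ M)"
  have wd: "w i ^ d = 1" if "i \<in> I" for i
    using N(3)[OF that] by (simp add: w_def N(1) mult.commute flip: power_mult)
  have G0: "(\<Sum>i\<in>I. c i * Re (\<xi> i * w i ^ j)) = 0" if "j < d" for j
    using coprime_conj[OF N(2,3) cop[OF that]] by (simp add: w_def mult.commute flip: power_mult)
  have "0 < d" using N by (cases d) auto
  \<comment> \<open>Index 0 takes the exceptional role; the sum there vanishes as well.\<close>
  have "of_nat d * fourier_class I c \<xi> w (w k) =
      of_real (2 * (\<Sum>i\<in>I. c i * Re (\<xi> i * w i ^ 0))) * cnj (w k) ^ 0"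
    by (rule fourier_class_eq[OF wd wd[OF k] \<open>0 < d\<close> G0])
  then have "of_nat d * fourier_class I c \<xi> w (w k) = 0"
    by (simp only: G0[OF \<open>0 < d\<close>]) simp
  then have "fourier_class I c \<xi> w (w k) = 0" using \<open>0 < d\<close> by simp
  moreover have "w k \<noteq> cnj (w k)"
  proof
    assume "w k = cnj (w k)"
    then have "w k * w k = 1"
      using unit_mult_cnj(1)[OF root_of_unity_norm[OF wd[OF k] \<open>0 < d\<close>]] by simp
    then show False using neq by (simp add: w_def mult_2 power_add)
  qed
  ultimately show False using class_nonzero[OF N(2,3) k] by blast
qed

text \<open>This is the order of the group generated by the \<open>\<xi> i\<close>. A bound on it is
  obtained by exhibiting a smaller common exponent.\<close>

definition "level N \<longleftrightarrow> N > 0 \<and> (\<forall>i\<in>I. \<xi> i ^ N = 1) \<and>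
    (\<forall>M. 0 < M \<and> M < N \<longrightarrow> (\<exists>i\<in>I. \<xi> i ^ M \<noteq> 1))"

lemma levelD: "level N \<Longrightarrow> N > 0" "level N \<Longrightarrow> i \<in> I \<Longrightarrow> \<xi> i ^ N = 1"
  by (auto simp: level_def)

lemma level_le:
  assumes "level N" "M > 0" "\<And>i. i \<in> I \<Longrightarrow> \<xi> i ^ M = 1"
  shows "N \<le> M"
  using assms by (meson level_def not_le)

text \<open>With \<open>N = 8 * L\<close> and \<open>M = 2 * L\<close>, every prime factor of
  \<open>N\<close> divides \<open>M\<close>, so all numbers \<open>1 + j * M\<close> are coprime to
  \<open>N\<close>. This gives the common exponent \<open>4 * L\<close>, half of
  \<open>N\<close>.\<close>

lemma not_8_dvd_level:
  assumes "level N"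
  shows "\<not> 8 dvd N"
proof
  assume "8 dvd N"
  then obtain L where L: "N = 8 * L" by blast
  have "\<xi> k ^ (2 * (2 * L)) = 1" if "k \<in> I" for k
  proof (rule power_eq_1_if_all_coprime[where d = 4 and N = N])
    fix j
    show "coprime (1 + j * (2 * L)) N"
    proof (rule coprime_1_plus)
      fix q assume q: "prime q" "q dvd N"
      then have "q dvd 2 ^ 3 * L" using L by simp
      then have "q dvd 2 \<or> q dvd L" using q(1) by (metis prime_dvd_mult_nat prime_dvd_power)
      then show "q dvd 2 * L" by auto
    qed (use levelD[OF assms] in auto)
  qed (use L levelD[OF assms] that in auto)
  then have "N \<le> 2 * (2 * L)"
    using level_le[OF assms, of "2 * (2 * L)"] levelD(1)[OF assms] L by auto
  then show False using L levelD(1)[OF assms] by simp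
qed

text \<open>The index \<open>j0\<close> is the one for which \<open>1 + j0 M\<close> may be divisible by \<open>p\<close>; the conjugation argument
  kills the sum at every other index.\<close>

lemma odd_prime_class_eq:
  assumes lev: "level N" and p: "prime p" "odd p" and N: "N = p * M"
  shows "\<exists>j0. \<forall>\<omega>. \<omega> ^ p = 1 \<longrightarrow> of_nat p * fourier_class I c \<xi> (\<lambda>i. \<xi> i ^ M) \<omega> =
        of_real (2 * (\<Sum>i\<in>I. c i * Re (\<xi> i * (\<xi> i ^ M) ^ j0))) * cnj \<omega> ^ j0"
proof -
  have wp: "(\<xi> i ^ M) ^ p = 1" if "i \<in> I" for i
    using levelD(2)[OF lev that] by (simp add: N mult.commute flip: power_mult)
  obtain j0 where j0: "j0 < p" "\<And>j. j < p \<Longrightarrow> j \<noteq> j0 \<Longrightarrow> \<not> p dvd 1 + j * M"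
  proof (cases "\<exists>j<p. p dvd 1 + j * M")
    case True
    then obtain j0 where j0: "j0 < p" "p dvd 1 + j0 * M" by blast
    have False if j: "j < p" "j \<noteq> j0" "p dvd 1 + j * M" for j
    proof -
      \<comment> \<open>Two such indices would make \<open>p\<close> divide
        \<open>(j - j0) * M\<close>, although \<open>p\<close> does not divide \<open>M\<close> and
        \<open>j\<close>, \<open>j0\<close> are distinct and below \<open>p\<close>.\<close>
      have "int p dvd int (1 + j * M) - int (1 + j0 * M)"
        using j j0 by (intro dvd_diff) (simp_all only: int_dvd_int_iff)
      then have "int p dvd (int j - int j0) * int M" by (simp add: algebra_simps)
      moreover have "\<not> int p dvd int M"
        using j p(1) by (metis dvd_add_left_iff dvd_mult int_dvd_int_iff not_prime_unit)
      ultimately have "int p dvd int j - int j0"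
        using p(1) by (simp add: prime_dvd_mult_iff)
      then show False using dvd_imp_le_int[of "int j - int j0" "int p"] j j0 by auto
    qed
    then show thesis using that j0 by blast
  next
    case False
    \<comment> \<open>With no exceptional index, 0 serves as a default.\<close>
    then show thesis using that[of 0] p(1) prime_gt_0_nat by blast
  qed
  have G0: "(\<Sum>i\<in>I. c i * Re (\<xi> i * (\<xi> i ^ M) ^ j)) = 0" if j: "j < p" "j \<noteq> j0" for j
  proof -
    have "coprime (1 + j * M) N"
    proof (rule ccontr)
      assume "\<not> coprime (1 + j * M) N"
      then obtain q where q: "prime q" "q dvd 1 + j * M" "q dvd N"
        using common_prime_factor by blast
      then have "q dvd p \<or> q dvd M" by (simp add: N prime_dvd_mult_iff)
      moreover have "\<not> q dvd p" using q j0(2)[OF j] p(1) primes_dvd_imp_eq by blast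
      moreover have "\<not> q dvd M" using q by (metis dvd_add_left_iff dvd_mult not_prime_unit)
      ultimately show False by blast
    qed
    from coprime_conj[OF levelD[OF lev] this]
    show ?thesis
      by (simp add: mult.commute flip: power_mult)
  qed
  show ?thesis
    using fourier_class_eq[of I "\<lambda>i. \<xi> i ^ M", OF wp _ j0(1) G0] by blast
qed

text \<open>A real \<open>p\<close>-th root of unity with \<open>p\<close> odd is 1, so otherwise
  \<open>M\<close> would be a smaller common exponent.\<close>

lemma odd_prime_nonreal_power:
  assumes lev: "level N" and p: "prime p" "odd p" and N: "N = p * M"
  shows "\<exists>k\<in>I. \<xi> k ^ M \<noteq> cnj (\<xi> k ^ M)"
proof (rule ccontr)
  assume *: "\<not> (\<exists>k\<in>I. \<xi> k ^ M \<noteq> cnj (\<xi> k ^ M))"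
  have "M > 0" using levelD(1)[OF lev] N by (cases M) auto
  moreover have "\<xi> k ^ M = 1" if "k \<in> I" for k
  proof -
    let ?w = "\<xi> k ^ M"
    have wp: "?w ^ p = 1"
      using levelD(2)[OF lev that] by (simp add: N mult.commute flip: power_mult)
    then have "?w * ?w = 1"
      using unit_mult_cnj(1)[OF root_of_unity_norm[OF wp prime_gt_0_nat[OF p(1)]]] * that by metis
    moreover obtain r where "p = 2 * r + 1" using p(2) by (elim oddE)
    ultimately show "?w = 1" using wp by (simp add: power_mult power2_eq_square)
  qed
  ultimately have "N \<le> M" using level_le[OF lev] by blast
  then show False using N \<open>M > 0\<close> prime_ge_2_nat[OF p(1)] by simp
qed

text \<open>If \<open>p\<close> divides \<open>N / p\<close>, then all conjugating numbers are
  coprime to \<open>N\<close> and every label is real, against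
  \<open>odd_prime_nonreal_power\<close>.\<close>

lemma odd_prime_square_not_dvd_level:
  assumes lev: "level N" and p: "prime p" "odd p"
  shows "\<not> p * p dvd N"
proof
  assume "p * p dvd N"
  then obtain L where "N = p * p * L" by (elim dvdE)
  then have L: "N = p * (p * L)" by simp
  obtain k where k: "k \<in> I" "\<xi> k ^ (p * L) \<noteq> cnj (\<xi> k ^ (p * L))"
    using odd_prime_nonreal_power[OF lev p L] by blast
  have "\<xi> k ^ (2 * (p * L)) = 1"
  proof (rule power_eq_1_if_all_coprime[OF L])
    fix j
    show "coprime (1 + j * (p * L)) N"
      by (rule coprime_1_plus) (use L levelD(1)[OF lev] in \<open>auto simp: prime_dvd_mult_iff\<close>)
  qed (use levelD lev k in auto)
  moreover have "norm (\<xi> k ^ (p * L)) = 1"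
    using root_of_unity_norm[OF levelD(2,1)[OF lev]] lev k by (simp add: norm_power)
  ultimately have "\<xi> k ^ (p * L) * \<xi> k ^ (p * L) = \<xi> k ^ (p * L) * cnj (\<xi> k ^ (p * L))"
    using unit_mult_cnj(1) by (metis mult_2 power_add)
  moreover have "\<xi> k ^ (p * L) \<noteq> 0"
    using \<open>norm (\<xi> k ^ (p * L)) = 1\<close> by (metis norm_zero zero_neq_one)
  ultimately show False using k(2) by simp
qed

text \<open>By \<open>odd_prime_class_eq\<close> all classes are one real number times a unit. It is
  nonzero because the class of a nonreal label is.\<close>

lemma odd_prime_classes_same_norm:
  assumes lev: "level N" and p: "prime p" "odd p" and N: "N = p * M"
  shows "\<exists>K>0. \<forall>\<omega>. \<omega> ^ p = 1 \<longrightarrow> norm (fourier_class I c \<xi> (\<lambda>i. \<xi> i ^ M) \<omega>) = K"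
proof -
  let ?cls = "fourier_class I c \<xi> (\<lambda>i. \<xi> i ^ M)"
  have p0: "p > 0" using p(1) prime_gt_0_nat by blast
  obtain S j0 where S: "\<And>\<omega>. \<omega> ^ p = 1 \<Longrightarrow> of_nat p * ?cls \<omega> = of_real S * cnj \<omega> ^ j0"
    using odd_prime_class_eq[OF lev p N] by blast
  define K where "K = \<bar>S\<bar> / real p"
  have K: "norm (?cls \<omega>) = K" if \<omega>: "\<omega> ^ p = 1" for \<omega>
  proof -
    have "real p * norm (?cls \<omega>) = \<bar>S\<bar>"
      using arg_cong[OF S[OF \<omega>], of norm] root_of_unity_norm[OF \<omega> p0]
      by (simp add: norm_mult norm_power)
    then show ?thesis using p0 by (simp add: K_def field_simps)
  qed
  obtain k where k: "k \<in> I" "\<xi> k ^ M \<noteq> cnj (\<xi> k ^ M)"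
    using odd_prime_nonreal_power[OF lev p N] by blast
  have "(\<xi> k ^ M) ^ p = 1"
    using levelD(2)[OF lev k(1)] by (simp add: N mult.commute flip: power_mult)
  then have "norm (?cls (\<xi> k ^ M)) = K" by (rule K)
  moreover have "?cls (\<xi> k ^ M) \<noteq> 0"
    using class_nonzero[of N k "\<lambda>i. \<xi> i ^ M"] levelD[OF lev] k by blast
  ultimately have "K > 0" by auto
  then show ?thesis using K by blast
qed

lemma roots_of_unity_subset_classes:
  assumes "K > 0" "\<And>\<omega>::complex. \<omega> ^ p = 1 \<Longrightarrow> norm (fourier_class I c \<xi> w \<omega>) = K"
  shows "{\<omega>::complex. \<omega> ^ p = 1} \<subseteq> (\<Union>i\<in>I. {w i, cnj (w i)})"
proof
  fix \<omega> :: complex assume "\<omega> \<in> {\<omega>. \<omega> ^ p = 1}"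
  then have "norm (fourier_class I c \<xi> w \<omega>) > 0" using assms by auto
  then have "fourier_class I c \<xi> w \<omega> \<noteq> 0" by auto
  then obtain i where "i \<in> I" "(if w i = \<omega> then of_real (c i) * \<xi> i else 0)
          + (if cnj (w i) = \<omega> then of_real (c i) * cnj (\<xi> i) else 0) \<noteq> 0"
    unfolding fourier_class_def by (rule sum.not_neutral_contains_not_neutral)
  then show "\<omega> \<in> (\<Union>i\<in>I. {w i, cnj (w i)})" by (auto split: if_splits)
qed

text \<open>Each of the \<open>p\<close> roots of unity has a nonzero class and therefore occurs as
  a label; three indices supply at most six labels.\<close>

lemma prime_dvd_level:
  assumes lev: "level N" and p: "prime p" "p dvd N"
  shows "p \<le> 5"
proof (cases "p = 2")
  case False
  then have odd: "odd p" using p(1) by (metis prime_odd_nat prime_ge_2_nat le_neq_implies_less)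
  obtain M where M: "N = p * M" using p(2) by blast
  obtain K where K: "K > 0" "\<And>\<omega>. \<omega> ^ p = 1 \<Longrightarrow> norm (fourier_class I c \<xi> (\<lambda>i. \<xi> i ^ M) \<omega>) = K"
    using odd_prime_classes_same_norm[OF lev p(1) odd M] by blast
  have "card {\<omega>::complex. \<omega> ^ p = 1} = p"
    using p(1) by (intro card_roots_unity_eq) (simp add: prime_gt_0_nat)
  then have "p \<le> card (\<Union>i\<in>I. {\<xi> i ^ M, cnj (\<xi> i ^ M)})"
    using card_mono[OF _ roots_of_unity_subset_classes[where p = p and w = "\<lambda>i. \<xi> i ^ M", OF K]] finite_I by auto
  also have "\<dots> \<le> (\<Sum>i\<in>I. card {\<xi> i ^ M, cnj (\<xi> i ^ M)})" using finite_I by (rule card_UN_le)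
  also have "\<dots> \<le> (\<Sum>i\<in>I. 2)" by (intro sum_mono) (simp add: card_insert_if)
  also have "\<dots> = 6" using card_I by simp
  finally have "p \<le> 6" .
  moreover have "p \<noteq> 6" using odd by auto
  ultimately show ?thesis by simp
qed simp

lemma level_dvd_60:
  assumes lev: "level N"
  shows "N dvd 60"
proof (rule multiplicity_le_imp_dvd)
  show "N \<noteq> 0" using levelD(1)[OF lev] by simp
  fix q :: nat assume q: "prime q"
  have le: "multiplicity q N \<le> k" if "\<not> q ^ Suc k dvd N" for k
    using that multiplicity_dvd'[of "Suc k" q N] by (cases "multiplicity q N \<le> k") auto
  have ge: "k \<le> multiplicity q 60" if "q ^ k dvd 60" for k
    using that q by (intro multiplicity_geI) auto
  show "multiplicity q N \<le> multiplicity q 60"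
  proof (cases "q dvd N")
    case True
    then have "q \<le> 5" using prime_dvd_level[OF lev q] by simp
    moreover have "q \<noteq> 4" using primes_dvd_imp_eq[of 2 q] q by auto
    moreover have "q \<ge> 2" using q by (rule prime_ge_2_nat)
    ultimately consider "q = 2" | "q = 3" | "q = 5" by linarith
    then show ?thesis
    proof cases
      case 1
      then show ?thesis using not_8_dvd_level[OF lev] le[of 2] ge[of 2] by simp
    next
      case 2
      then show ?thesis using odd_prime_square_not_dvd_level[OF lev q] le[of 1] ge[of 1] by simp
    next
      case 3
      then show ?thesis using odd_prime_square_not_dvd_level[OF lev q] le[of 1] ge[of 1] by simp
    qed
  next
    case False
    then show ?thesis using le[of 0] by simp
  qed
qed

end

section \<open>Real parts of twelfth roots of unity and the exclusion of the prime 5\<close>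

lemma sqrt_3_irrational: "sqrt 3 \<notin> \<rat>"
proof
  assume "sqrt 3 \<in> \<rat>"
  then obtain m n :: nat where mn: "n \<noteq> 0" "\<bar>sqrt 3\<bar> = real m / real n" "coprime m n"
    by (rule Rats_abs_nat_div_natE)
  then have "real m = sqrt 3 * real n" by (simp add: field_simps)
  then have "(real m)\<^sup>2 = 3 * (real n)\<^sup>2" by (simp add: power_mult_distrib)
  then have "real (m\<^sup>2) = real (3 * n\<^sup>2)" by simp
  then have eq: "m\<^sup>2 = 3 * n\<^sup>2" by (simp only: of_nat_eq_iff)
  then have "n\<^sup>2 dvd m\<^sup>2" by simp
  moreover have "coprime (m\<^sup>2) (n\<^sup>2)" using mn(3) by simp
  ultimately have "n\<^sup>2 = 1" by (metis coprime_common_divisor_nat dvd_refl)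
  then have "m * m = 3" using eq by (simp add: power2_eq_square)
  consider "m = 0" | "m = 1" | "m \<ge> 2" by linarith
  then show False
    using \<open>m * m = 3\<close> mult_le_mono[of 2 m 2 m] by cases auto
qed

text \<open>With \<open>t = z + 1 / z = 2 * Re z\<close>, the polynomial \<open>z ^ 12 - 1\<close>
  is a power of \<open>z\<close> times
  \<open>(z - 1) (z + 1) t (t + 1) (t - 1) (t^2 - 3)\<close>.\<close>

lemma Re_12th_root:
  assumes "z ^ 12 = (1::complex)"
  shows "\<bar>Re z\<bar> \<in> {0, 1/2, sqrt 3 / 2, 1}"
proof -
  have n: "norm z = 1" using root_of_unity_norm[OF assms] by simp
  have zc: "z * cnj z = 1" using unit_mult_cnj(1)[OF n] .
  have z0: "z \<noteq> 0" using n by auto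
  define t where "t = z + cnj z"
  have t: "t = of_real (2 * Re z)" by (simp only: t_def complex_add_cnj)
  have zt: "z * t = z\<^sup>2 + 1" using zc by (simp add: t_def power2_eq_square algebra_simps)
  have "(z - 1) * (z + 1) * (z\<^sup>2 + 1) * (z\<^sup>2 + 1 + z) * (z\<^sup>2 + 1 - z) * ((z\<^sup>2 + 1)\<^sup>2 - 3 * z\<^sup>2)
      = (z\<^sup>2 - 1) * (z\<^sup>2 + 1) * ((z\<^sup>2 + 1)\<^sup>2 - z\<^sup>2) * ((z\<^sup>2 + 1)\<^sup>2 - 3 * z\<^sup>2)"
    by (simp add: power2_eq_square algebra_simps)
  also have "\<dots> = ((z\<^sup>2 - 1) * ((z\<^sup>2 + 1)\<^sup>2 - z\<^sup>2)) * ((z\<^sup>2 + 1) * ((z\<^sup>2 + 1)\<^sup>2 - 3 * z\<^sup>2))"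
    by (simp only: ac_simps)
  also have "(z\<^sup>2 - 1) * ((z\<^sup>2 + 1)\<^sup>2 - z\<^sup>2) = z ^ 6 - 1"
    by (simp add: eval_nat_numeral algebra_simps)
  also have "(z\<^sup>2 + 1) * ((z\<^sup>2 + 1)\<^sup>2 - 3 * z\<^sup>2) = z ^ 6 + 1"
    by (simp add: eval_nat_numeral algebra_simps)
  also have "(z ^ 6 - 1) * (z ^ 6 + 1) = z ^ 12 - 1"
    by (simp add: algebra_simps flip: power_add)
  finally have "(z - 1) * (z + 1) * (z\<^sup>2 + 1) * (z\<^sup>2 + 1 + z) * (z\<^sup>2 + 1 - z) * ((z\<^sup>2 + 1)\<^sup>2 - 3 * z\<^sup>2) = z ^ 12 - 1" .
  then have "(z - 1) * (z + 1) * (z * t) * (z * t + z) * (z * t - z) * ((z * t)\<^sup>2 - 3 * z\<^sup>2) = 0"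
    using assms by (simp only: zt) simp
  moreover have "z * t + z = z * (t + 1)" "z * t - z = z * (t - 1)"
    "(z * t)\<^sup>2 - 3 * z\<^sup>2 = z\<^sup>2 * (t\<^sup>2 - 3)"
    by (simp_all add: power_mult_distrib algebra_simps)
  ultimately have "(z - 1) * (z + 1) * (z * t) * (z * (t + 1)) * (z * (t - 1)) * (z\<^sup>2 * (t\<^sup>2 - 3)) = 0"
    by (simp only:)
  then consider "z = 1" | "z = -1" | "t = 0" | "t = -1" | "t = 1" | "t\<^sup>2 = 3"
    using z0 by (auto simp: eq_neg_iff_add_eq_0)
  then show ?thesis
  proof cases
    case 4
    then have "2 * Re z = -1" using t by (metis of_real_eq_iff of_real_minus of_real_1)
    then have "Re z = -1/2" by simp
    then show ?thesis by simp
  next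
    case 5
    then have "2 * Re z = 1" using t by (metis of_real_eq_1_iff)
    then have "Re z = 1/2" by simp
    then show ?thesis by simp
  next
    case 6
    then have "complex_of_real ((2 * Re z)\<^sup>2) = of_real 3" using t by simp
    then have "(2 * Re z)\<^sup>2 = 3" by (simp only: of_real_eq_iff)
    then have "\<bar>2 * Re z\<bar> = sqrt 3" by (metis real_sqrt_abs)
    then show ?thesis by (simp add: abs_mult)
  qed (use t in auto)
qed

context cosine_relation
begin

text \<open>All five Fourier classes would be nonzero of the same absolute value, which forces
  \<open>\<bar>Re (\<xi> l)\<bar> = 1/4\<close> for a twelfth root of unity \<open>\<xi> l\<close>.\<close>

lemma not_5_dvd_level:
  assumes lev: "level N"
  shows "\<not> 5 dvd N"
proof
  assume "5 dvd N"
  then obtain M where M: "N = 5 * M" by blast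
  have p: "prime (5::nat)" "odd (5::nat)" by simp_all
  have "5 * M dvd 5 * 12" using level_dvd_60[OF lev] M by simp
  then have M12: "M dvd 12" by (simp only: nat_mult_dvd_cancel_disj) simp
  define w where "w = (\<lambda>i. \<xi> i ^ M)"
  have n: "norm (\<xi> i) = 1" if "i \<in> I" for i
    using root_of_unity_norm[OF levelD(2,1)[OF lev]] that lev by simp
  obtain K where K: "K > 0" "\<And>\<omega>. \<omega> ^ 5 = 1 \<Longrightarrow> norm (fourier_class I c \<xi> w \<omega>) = K"
    using odd_prime_classes_same_norm[OF lev p M] unfolding w_def by blast
  have w5: "w i ^ 5 = 1" if "i \<in> I" for i
    using levelD(2)[OF lev that] by (simp add: w_def M mult.commute flip: power_mult)
  have sub: "{\<omega>. \<omega> ^ 5 = 1} \<subseteq> (\<Union>i\<in>I. {w i, cnj (w i)})" by (rule roots_of_unity_subset_classes[OF K])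
  have card5: "card {\<omega>::complex. \<omega> ^ 5 = 1} = 5" by (intro card_roots_unity_eq) simp
  \<comment> \<open>Every fifth root of unity occurs as a label, 1 among them.\<close>
  obtain l where l: "l \<in> I" "w l = 1" 
  proof -
    have "1 \<in> {\<omega>::complex. \<omega> ^ 5 = 1}" by simp
    then obtain i where "i \<in> I" "1 = w i \<or> 1 = cnj (w i)" using sub by blast
    then show thesis using that by (metis complex_cnj_one_iff)
  qed
  obtain i j where ij: "I = {i, j, l}" "i \<noteq> j" "i \<noteq> l" "j \<noteq> l"
    using card_I l(1) by (auto simp: card_3_iff)
  have "(\<Union>i\<in>I. {w i, cnj (w i)}) = {1, w i, cnj (w i), w j, cnj (w j)}"
    unfolding ij(1) by (auto simp: l(2))
  then have "{\<omega>. \<omega> ^ 5 = 1} \<subseteq> {1, w i, cnj (w i), w j, cnj (w j)}" using sub by simp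
  from card_mono[OF _ this] have "5 \<le> card {1, w i, cnj (w i), w j, cnj (w j)}"
    unfolding card5 by simp
  \<comment> \<open>The index \<open>l\<close> uses up only the label 1, so the remaining two
    indices must supply the other four roots without repetition.\<close>
  then have dist: "distinct [1, w i, cnj (w i), w j, cnj (w j)]"
    by (intro card_distinct) (simp add: card_insert_if split: if_splits)
  have c1: "fourier_class I c \<xi> w 1 = of_real (c l * (2 * Re (\<xi> l)))"
    using ij dist l(2) unfolding fourier_class_def
    by (auto simp: complex_eq_iff)
  have c2: "fourier_class I c \<xi> w (w i) = of_real (c i) * \<xi> i"
    using ij dist l(2) unfolding fourier_class_def by auto
  have c3: "fourier_class I c \<xi> w (w j) = of_real (c j) * \<xi> j"
    using ij dist l(2) unfolding fourier_class_def by auto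
  have I: "i \<in> I" "j \<in> I" using ij(1) by auto
  have "\<bar>c i\<bar> = K" using K(2)[OF w5[OF I(1)]] n[OF I(1)] by (simp add: c2 norm_mult)
  moreover have "\<bar>c j\<bar> = K" using K(2)[OF w5[OF I(2)]] n[OF I(2)] by (simp add: c3 norm_mult)
  moreover have "c i + c j + c l = 0" using sum_c ij by (simp add: add.assoc)
  moreover have "c l \<noteq> 0" using nz l by simp
  \<comment> \<open>If \<open>c i\<close> and \<open>c j\<close> had opposite signs,
    \<open>c l\<close> would be zero.\<close>
  ultimately have "\<bar>c l\<bar> = 2 * K" by linarith
  moreover have "\<bar>c l\<bar> * (2 * \<bar>Re (\<xi> l)\<bar>) = K"
    using K(2)[of 1] by (simp add: c1 norm_mult abs_mult)
  ultimately have "\<bar>Re (\<xi> l)\<bar> = 1/4" using K(1) by (simp add: field_simps)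
  moreover have "\<xi> l ^ 12 = 1"
    using l(2) M12 unfolding w_def by (metis dvd_def power_mult power_one)
  moreover have "sqrt 3 / 2 \<noteq> 1/4"
  proof -
    have "sqrt 3 \<ge> 1" by simp
    then show ?thesis by linarith
  qed
  ultimately show False using Re_12th_root[of "\<xi> l"] by simp
qed

text \<open>The level divides 60 and is prime to 5, so it divides 12. Three distinct absolute values
  remain among four candidates, and \<open>sqrt 3 / 2\<close> cannot be one of them: it would be the
  only irrational cosine in a rational relation.\<close>

theorem cosine_values:
  assumes "n > 0" "\<And>i. i \<in> I \<Longrightarrow> \<xi> i ^ n = 1"
  shows "(\<lambda>i. \<bar>Re (\<xi> i)\<bar>) ` I = {0, 1/2, 1}"
proof -
  let ?f = "\<lambda>i. \<bar>Re (\<xi> i)\<bar>"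
  define P where "P = (\<lambda>N. N > 0 \<and> (\<forall>i\<in>I. \<xi> i ^ N = 1))"
  have "P (LEAST N. P N)" using assms by (intro LeastI[of P n]) (auto simp: P_def)
  then have lev: "level (LEAST N. P N)"
    unfolding level_def using not_less_Least[of _ P] by (auto simp: P_def)
  have "(LEAST N. P N) dvd 12"
  proof -
    have "(LEAST N. P N) dvd 12 * 5" using level_dvd_60[OF lev] by simp
    moreover have "coprime (LEAST N. P N) 5"
      using not_5_dvd_level[OF lev] prime_imp_coprime[of "5::nat"] by (simp add: coprime_commute)
    ultimately show ?thesis by (simp only: coprime_dvd_mult_left_iff)
  qed
  then have 12: "\<xi> i ^ 12 = 1" if "i \<in> I" for i
    using levelD(2)[OF lev that] by (metis dvd_def power_mult power_one)
  have sub: "?f ` I \<subseteq> {0, 1/2, sqrt 3 / 2, 1}" using Re_12th_root 12 by blast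
  have inj': "inj_on ?f I"
    using inj no_opposite by (auto simp: inj_on_def abs_eq_iff)
  have "sqrt 3 / 2 \<notin> ?f ` I"
  proof
    assume "sqrt 3 / 2 \<in> ?f ` I"
    then obtain k where k: "k \<in> I" "\<bar>Re (\<xi> k)\<bar> = sqrt 3 / 2" by auto
    have "Re (\<xi> i) \<in> \<rat>" if "i \<in> I - {k}" for i
    proof -
      have "?f i \<noteq> sqrt 3 / 2" using inj' that k by (metis DiffD1 DiffD2 inj_onD singletonI)
      then have "?f i \<in> {0, 1/2, 1}" using sub that by blast
      then have "Re (\<xi> i) = 0 \<or> Re (\<xi> i) = 1/2 \<or> Re (\<xi> i) = - (1/2) \<or> Re (\<xi> i) = 1 \<or> Re (\<xi> i) = - 1"
        by auto
      then show ?thesis by (elim disjE) (simp_all only: Rats_minus_iff, simp_all)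
    qed
    then have "(\<Sum>i\<in>I-{k}. c i * Re (\<xi> i)) \<in> \<rat>" using rat by (intro Rats_sum Rats_mult) auto
    moreover have "c k * Re (\<xi> k) = - (\<Sum>i\<in>I-{k}. c i * Re (\<xi> i))"
      using rel finite_I k by (simp add: sum.remove)
    ultimately have "c k * Re (\<xi> k) \<in> \<rat>" by simp
    then have "c k * Re (\<xi> k) / c k \<in> \<rat>" using rat k by (intro Rats_divide) auto
    then have "Re (\<xi> k) \<in> \<rat>" using nz k by simp
    then have "sqrt 3 / 2 \<in> \<rat>" using k(2) by (metis Rats_abs_iff)
    then have "sqrt 3 / 2 * 2 \<in> \<rat>" by (intro Rats_mult) auto
    then show False using sqrt_3_irrational by simp
  qed
  then have no_sqrt: "x \<noteq> sqrt 3 / 2" if "x \<in> ?f ` I" for x using that by metis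
  have sub': "?f ` I \<subseteq> {0, 1/2, 1}"
  proof
    fix x assume "x \<in> ?f ` I"
    then show "x \<in> {0, 1/2, 1}" using subsetD[OF sub, of x] no_sqrt[of x] by simp
  qed
  have "card (?f ` I) = 3" using card_image[OF inj'] card_I by simp
  moreover have "card {0, 1/2, 1::real} = 3" by simp
  ultimately show ?thesis using card_subset_eq[OF _ sub'] by simp
qed

end

lemma cosine_dichotomy:
  fixes \<xi> :: "'i \<Rightarrow> complex" and c :: "'i \<Rightarrow> real"
  assumes "card I = 3" "\<And>i. i \<in> I \<Longrightarrow> c i \<in> \<rat>" "\<And>i. i \<in> I \<Longrightarrow> c i \<noteq> 0"
    "(\<Sum>i\<in>I. c i) = 0" "(\<Sum>i\<in>I. c i * Re (\<xi> i)) = 0" "inj_on (\<lambda>i. Re (\<xi> i)) I"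
    and "n > 0" "\<And>i. i \<in> I \<Longrightarrow> \<xi> i ^ n = 1"
  obtains i j where "i \<in> I" "j \<in> I" "i \<noteq> j" "Re (\<xi> i) = - Re (\<xi> j)"
  | "(\<lambda>i. \<bar>Re (\<xi> i)\<bar>) ` I = {0, 1/2, 1}"
proof (cases "\<exists>i\<in>I. \<exists>j\<in>I. i \<noteq> j \<and> Re (\<xi> i) = - Re (\<xi> j)")
  case True
  then show thesis using that(1) by blast
next
  case False
  then interpret cosine_relation I \<xi> c
    using assms(1-6) by unfold_locales auto
  show thesis using cosine_values assms(7,8) that(2) by blast
qed

section \<open>Homothetic spaces\<close>

text \<open>The vectors \<open>c * a\<close>, \<open>c * b\<close> have coordinates in
  \<open>a'\<close>, \<open>b'\<close> forming an invertible rational matrix.\<close>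

lemma qspan2_change_basis:
  fixes p q r s :: rat
  assumes det: "p * s - q * r \<noteq> 0"
    and a: "c * a = of_real (of_rat s) * a' + of_real (of_rat r) * b'"
    and b: "c * b = of_real (of_rat q) * a' + of_real (of_rat p) * b'"
  shows "qspan2 a' b' = (*) c ` qspan2 a b"
proof (intro set_eqI iffI)
  let ?R = "\<lambda>x::rat. complex_of_real (of_rat x)"
  fix z
  {
    assume "z \<in> qspan2 a' b'"
    then obtain u v where z: "z = ?R u * a' + ?R v * b'" by (auto simp: qspan2_def)
    define D where "D = p * s - q * r"
    \<comment> \<open>Cramer's rule for \<open>u = x * s + y * q\<close>,
      \<open>v = x * r + y * p\<close>.\<close>
    define x y where "x = (p * u - q * v) / D" and "y = (s * v - r * u) / D"
    have D: "D \<noteq> 0" using det by (simp add: D_def)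
    have "x * s + y * q = ((p * u - q * v) * s + (s * v - r * u) * q) / D"
      "x * r + y * p = ((p * u - q * v) * r + (s * v - r * u) * p) / D"
      by (simp_all add: x_def y_def add_divide_distrib)
    moreover have "(p * u - q * v) * s + (s * v - r * u) * q = u * D"
      "(p * u - q * v) * r + (s * v - r * u) * p = v * D"
      by (simp_all add: D_def algebra_simps)
    ultimately have uv: "u = x * s + y * q" "v = x * r + y * p" using D by simp_all
    have "z = ?R x * (c * a) + ?R y * (c * b)"
      unfolding z uv a b by (simp add: of_rat_add of_rat_mult algebra_simps)
    also have "\<dots> = c * (?R x * a + ?R y * b)" by (simp add: algebra_simps)
    finally show "z \<in> (*) c ` qspan2 a b" by (auto simp: qspan2_def)
  }
  assume "z \<in> (*) c ` qspan2 a b"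
  then obtain x y where "z = c * (?R x * a + ?R y * b)" by (auto simp: qspan2_def)
  also have "\<dots> = ?R x * (c * a) + ?R y * (c * b)" by (simp add: algebra_simps)
  also have "\<dots> = ?R (x * s + y * q) * a' + ?R (x * r + y * p) * b'"
    unfolding a b by (simp add: of_rat_add of_rat_mult algebra_simps)
  finally show "z \<in> qspan2 a' b'" unfolding qspan2_def by blast
qed

lemma homothetic_qspan2:
  fixes p q r s :: rat
  assumes "c \<noteq> 0" "p * s - q * r \<noteq> 0"
    "c * a = of_real (of_rat s) * a' + of_real (of_rat r) * b'"
    "c * b = of_real (of_rat q) * a' + of_real (of_rat p) * b'"
  shows "homothetic (qspan2 a b) (qspan2 a' b')"
  using assms(1) qspan2_change_basis[OF assms(2-4)] unfolding homothetic_def by blast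

text \<open>Multiplication by \<open>r \<tau> + s\<close> sends 1 to \<open>r \<tau> + s\<close> and
  \<open>\<sigma>\<close> to \<open>p \<tau> + q\<close>; it is nonzero since \<open>\<tau>\<close>
  is not real.\<close>

lemma homothetic_moebius:
  fixes p q r s :: rat
  assumes im: "Im \<tau> \<noteq> 0" and det: "p * s - q * r \<noteq> 0"
    and eq: "\<sigma> * (of_real (of_rat r) * \<tau> + of_real (of_rat s)) = of_real (of_rat p) * \<tau> + of_real (of_rat q)"
  shows "homothetic (qspan2 1 \<sigma>) (qspan2 1 \<tau>)"
proof (rule homothetic_qspan2[where p = p and q = q and r = r and s = s])
  show "of_real (of_rat r) * \<tau> + of_real (of_rat s) \<noteq> 0"
  proof
    assume *: "of_real (of_rat r) * \<tau> + of_real (of_rat s) = 0"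
    from arg_cong[OF this, of Im] im have "r = 0" by simp
    with * have "s = 0" by simp
    with \<open>r = 0\<close> det show False by simp
  qed
qed (use det eq in \<open>simp_all add: algebra_simps\<close>)

lemma homothetic_sym:
  assumes "homothetic V W"
  shows "homothetic W V"
proof -
  obtain c where c: "c \<noteq> 0" "W = (\<lambda>z. c * z) ` V" using assms by (auto simp: homothetic_def)
  then have "V = (\<lambda>z. inverse c * z) ` W" by (simp add: image_image mult.assoc[symmetric])
  then show ?thesis using c(1) unfolding homothetic_def by (metis inverse_nonzero_iff_nonzero)
qed

lemma homothetic_trans:
  assumes "homothetic U V" "homothetic V W"
  shows "homothetic U W"
proof -
  obtain c d where "c \<noteq> 0" "V = (\<lambda>z. c * z) ` U" "d \<noteq> 0" "W = (\<lambda>z. d * z) ` V"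
    using assms by (auto simp: homothetic_def)
  then show ?thesis
    unfolding homothetic_def by (intro exI[of _ "d * c"]) (simp add: image_image mult.assoc)
qed

lemma homothetic_refl: "homothetic V V"
  unfolding homothetic_def by (intro exI[of _ 1]) simp

lemma superrectangularI:
  assumes "homothetic V (qspan2 1 \<tau>)" "n > 0" "\<tau> ^ n = 1"
  shows "\<exists>W. superrectangular W \<and> homothetic V W"
  using assms homothetic_refl unfolding superrectangular_def by blast

section \<open>Rational directions and superrectangular spaces\<close>

lemma unit_Re_eq:
  assumes "norm x = 1" "norm y = 1" "Re x = Re y"
  shows "x = y \<or> x = cnj y"
proof -
  have "(Re x)\<^sup>2 + (Im x)\<^sup>2 = 1" "(Re y)\<^sup>2 + (Im y)\<^sup>2 = 1"
    using assms(1,2) by (simp_all add: cmod_def)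
  then have "(Im x)\<^sup>2 = (Im y)\<^sup>2" using assms(3) by simp
  then show ?thesis using assms(3) by (auto simp: power2_eq_iff complex_eq_iff)
qed

text \<open>\<open>z / cnj z\<close> is \<open>cis (2 * Arg z)\<close>, so the denominator of
  \<open>r\<close> serves as exponent.\<close>

lemma direction_root_of_unity:
  assumes "Arg z = of_rat r * pi" "z \<noteq> 0"
  shows "\<exists>n>0. (z / cnj z) ^ n = 1"
proof -
  obtain a b where ab: "quotient_of r = (a, b)" by fastforce
  then have b: "b > 0" and r: "r = of_int a / of_int b"
    using quotient_of_denom_pos quotient_of_div by auto
  have z: "z = of_real (norm z) * cis (Arg z)"
    using Arg_eq[OF assms(2)] by (simp add: cis_conv_exp)
  have "z / cnj z = cis (Arg z) / cnj (cis (Arg z))"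
    using assms(2) by (subst (1 2) z) simp
  also have "\<dots> = cis (2 * Arg z)"
    by (simp add: cis_cnj cis_divide)
  finally have dir: "z / cnj z = cis (2 * Arg z)" .
  have "(z / cnj z) ^ nat b = cis (real (nat b) * (2 * Arg z))"
    unfolding dir by (rule Complex.DeMoivre)
  also have "real (nat b) * (2 * Arg z) = 2 * pi * of_int a"
    using b unfolding assms(1) r by (simp add: of_rat_divide field_simps)
  also have "cis (2 * pi * of_int a) = 1" by (rule cis_multiple_2pi) simp
  finally show ?thesis using b by (intro exI[of _ "nat b"]) simp
qed

text \<open>The vectors \<open>\<sigma> + a\<close> and \<open>\<sigma> + b\<close> are orthogonal.
  The reflection \<open>z \<mapsto> m * cnj z\<close> in the line of the first sends 1 to
  \<open>m\<close>, and adding the two equations exhibits \<open>m\<close> in the space.\<close>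

lemma superrectangular_opposite_directions:
  fixes a b :: rat
  assumes im: "Im \<sigma> \<noteq> 0" and ab: "a \<noteq> b" and n: "n > 0" "m ^ n = 1"
    and a: "\<sigma> + of_real (of_rat a) = m * (cnj \<sigma> + of_real (of_rat a))"
    and b: "\<sigma> + of_real (of_rat b) = - m * (cnj \<sigma> + of_real (of_rat b))"
  shows "\<exists>W. superrectangular W \<and> homothetic (qspan2 1 \<sigma>) W"
proof (rule superrectangularI[OF _ n])
  have "m * of_real (of_rat (a - b)) = 2 * \<sigma> + of_real (of_rat (a + b))"
  proof -
    have "2 * \<sigma> + of_real (of_rat (a + b))
       = (\<sigma> + of_real (of_rat a)) + (\<sigma> + of_real (of_rat b))" by (simp add: of_rat_add)
    also have "\<dots> = m * of_real (of_rat (a - b))"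
      unfolding a b by (simp add: of_rat_diff algebra_simps)
    finally show ?thesis by simp
  qed
  then have "homothetic (qspan2 1 m) (qspan2 1 \<sigma>)"
    using im ab by (intro homothetic_moebius[where p = 2 and q = "a + b" and r = 0 and s = "a - b"]) auto
  then show "homothetic (qspan2 1 \<sigma>) (qspan2 1 m)" by (rule homothetic_sym)
qed

text \<open>Here \<open>\<sigma> + b\<close> is orthogonal to 1, so complex conjugation preserves
  the space. Hence \<open>m\<close>, the quotient of \<open>\<sigma> + a\<close> by its conjugate,
  is a rational Moebius image of \<open>\<sigma>\<close>.\<close>

lemma superrectangular_imaginary_direction:
  fixes a b :: rat
  assumes im: "Im \<sigma> \<noteq> 0" and ab: "a \<noteq> b" and n: "n > 0" "m ^ n = 1"
    and a: "\<sigma> + of_real (of_rat a) = m * (cnj \<sigma> + of_real (of_rat a))"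
    and b: "\<sigma> + of_real (of_rat b) = - (cnj \<sigma> + of_real (of_rat b))"
  shows "\<exists>W. superrectangular W \<and> homothetic (qspan2 1 \<sigma>) W"
proof (rule superrectangularI[OF _ n])
  have c: "cnj \<sigma> = - \<sigma> - 2 * of_real (of_rat b)"
    using b by (simp add: algebra_simps eq_neg_iff_add_eq_0)
  have "m * (- \<sigma> + of_real (of_rat (a - 2 * b))) = \<sigma> + of_real (of_rat a)"
    unfolding a c by (simp add: of_rat_diff of_rat_mult algebra_simps)
  then have "homothetic (qspan2 1 m) (qspan2 1 \<sigma>)"
    using im ab by (intro homothetic_moebius[where p = 1 and q = a and r = "- 1" and s = "a - 2 * b"]) auto
  then show "homothetic (qspan2 1 \<sigma>) (qspan2 1 m)" by (rule homothetic_sym)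
qed

text \<open>The eight values of \<open>w\<close> are obtained from \<open>tau1\<close>, \<open>tau2\<close> by conjugation, inversion and rational
  scaling, where \<open>cnj tau1 = (1 - tau1) / (1 + tau1)\<close> and
  \<open>cnj tau2 = - 3 * (tau2 + 1) / (tau2 + 3)\<close>.\<close>

lemma dodecagonal_cases:
  fixes \<epsilon> t :: real
  assumes \<epsilon>: "\<epsilon> = 1 \<or> \<epsilon> = -1" and t: "t = sqrt 3 \<or> t = - sqrt 3 \<or> t = sqrt 3 / 3 \<or> t = - sqrt 3 / 3"
    and w: "w = Complex (1 / (t - 1)) (\<epsilon> / (t - 1))"
  shows "homothetic (qspan2 1 w) (qspan2 1 tau1) \<or> homothetic (qspan2 1 w) (qspan2 1 tau2)"
proof -
  define h where "h = sqrt 3"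
  have h: "h * h = 3" "h > 0" by (simp_all add: h_def)
  have h1: "h \<noteq> 1" "h \<noteq> - 1" "h \<noteq> 3" "h \<noteq> - 3" using h by auto
  define x where "x = 1 / (t - 1)"
  have x: "x = (h + 1) / 2 \<or> x = - (h - 1) / 2 \<or> x = - (3 + h) / 2 \<or> x = - (3 - h) / 2"
  proof -
    have "1 / (h - 1) = (h + 1) / 2" "1 / (- h - 1) = - (h - 1) / 2"
      "1 / (h / 3 - 1) = - (3 + h) / 2" "1 / (- h / 3 - 1) = - (3 - h) / 2"
      using h h1 by (simp_all add: field_simps)
    then show ?thesis using t unfolding h_def[symmetric] x_def by metis
  qed
  have \<tau>: "tau1 = Complex ((h - 1) / 2) ((h - 1) / 2)" "tau2 = Complex (- (3 - h) / 2) ((3 - h) / 2)"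
    by (simp_all add: tau1_def tau2_def h_def complex_eq_iff)
  have im: "Im tau1 \<noteq> 0" "Im tau2 \<noteq> 0" using h1 by (simp_all add: \<tau>)
  \<comment> \<open>In the eight cases the arguments are the coefficients of
    \<open>w = (p \<tau> + q) / (r \<tau> + s)\<close>, in the order \<open>p\<close>,
    \<open>s\<close>, \<open>q\<close>, \<open>r\<close>.\<close>
  note m1 = homothetic_moebius[OF im(1), of _ _ _ _ w]
  note m2 = homothetic_moebius[OF im(2), of _ _ _ _ w]
  have w: "w = Complex x (\<epsilon> * x)" by (simp add: w x_def)
  show ?thesis
    using \<epsilon> x
  proof (elim disjE)
    assume e: "\<epsilon> = 1" "x = (h + 1) / 2"
    have w': "w = Complex ((h + 1) / 2) (((h + 1) / 2))" by (simp only: w e mult_1 mult_minus1)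
    show ?thesis
      using h by (intro disjI1 m1[of 1 1 1 "-1"]) (simp_all add: w' \<tau> complex_eq_iff field_simps)
  next
    assume e: "\<epsilon> = 1" "x = - (h - 1) / 2"
    have w': "w = Complex (- (h - 1) / 2) ((- (h - 1) / 2))" by (simp only: w e mult_1 mult_minus1)
    show ?thesis
      using h by (intro disjI1 m1[of "-1" 1 0 0]) (simp_all add: w' \<tau> complex_eq_iff field_simps)
  next
    assume e: "\<epsilon> = 1" "x = - (3 + h) / 2"
    have w': "w = Complex (- (3 + h) / 2) ((- (3 + h) / 2))" by (simp only: w e mult_1 mult_minus1)
    show ?thesis
      using h by (intro disjI2 m2[of 0 0 3 1]) (simp_all add: w' \<tau> complex_eq_iff field_simps)
  next
    assume e: "\<epsilon> = 1" "x = - (3 - h) / 2"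
    have w': "w = Complex (- (3 - h) / 2) ((- (3 - h) / 2))" by (simp only: w e mult_1 mult_minus1)
    show ?thesis
      using h by (intro disjI2 m2[of "-3" 3 "-3" 1]) (simp_all add: w' \<tau> complex_eq_iff field_simps)
  next
    assume e: "\<epsilon> = -1" "x = (h + 1) / 2"
    have w': "w = Complex ((h + 1) / 2) (- ((h + 1) / 2))" by (simp only: w e mult_1 mult_minus1)
    show ?thesis
      using h by (intro disjI1 m1[of 0 0 1 1]) (simp_all add: w' \<tau> complex_eq_iff field_simps)
  next
    assume e: "\<epsilon> = -1" "x = - (h - 1) / 2"
    have w': "w = Complex (- (h - 1) / 2) (- (- (h - 1) / 2))" by (simp only: w e mult_1 mult_minus1)
    show ?thesis
      using h by (intro disjI1 m1[of 1 1 "-1" 1]) (simp_all add: w' \<tau> complex_eq_iff field_simps)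
  next
    assume e: "\<epsilon> = -1" "x = - (3 + h) / 2"
    have w': "w = Complex (- (3 + h) / 2) (- (- (3 + h) / 2))" by (simp only: w e mult_1 mult_minus1)
    show ?thesis
      using h by (intro disjI2 m2[of 1 "-1" 3 "-1"]) (simp_all add: w' \<tau> complex_eq_iff field_simps)
  next
    assume e: "\<epsilon> = -1" "x = - (3 - h) / 2"
    have w': "w = Complex (- (3 - h) / 2) (- (- (3 - h) / 2))" by (simp only: w e mult_1 mult_minus1)
    show ?thesis
      using h by (intro disjI2 m2[of 1 1 0 0]) (simp_all add: w' \<tau> complex_eq_iff field_simps)
  qed
qed

text \<open>The condition on \<open>k\<close> puts \<open>\<sigma> + b\<close> on a diagonal. The
  condition on \<open>m\<close>, a primitive third or sixth root of unity, makes the slope of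
  \<open>\<sigma> + a\<close> plus or minus \<open>sqrt 3\<close> or \<open>1 / sqrt 3\<close>. Both
  vectors have the same imaginary part and differ by the rational \<open>a - b\<close>, so up to
  that factor eight positions remain.\<close>

lemma dodecagonal:
  fixes a b :: rat
  assumes im: "Im \<sigma> \<noteq> 0" and ab: "a \<noteq> b"
    and a: "\<sigma> + of_real (of_rat a) = m * (cnj \<sigma> + of_real (of_rat a))" and m: "m ^ 4 + m\<^sup>2 + 1 = 0"
    and b: "\<sigma> + of_real (of_rat b) = k * (cnj \<sigma> + of_real (of_rat b))" and k: "k\<^sup>2 = - 1"
  shows "homothetic (qspan2 1 \<sigma>) (qspan2 1 tau1) \<or> homothetic (qspan2 1 \<sigma>) (qspan2 1 tau2)"
proof -
  define x y d where "x = Re \<sigma> + of_rat b" and "y = Im \<sigma>" and "d = (of_rat (a - b) :: real)"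
  have d: "d \<noteq> 0" using ab by (simp add: d_def)
  have y: "y \<noteq> 0" using im by (simp add: y_def)
  have zb: "\<sigma> + of_real (of_rat b) = Complex x y" by (simp add: x_def y_def complex_eq_iff)
  have za: "\<sigma> + of_real (of_rat a) = Complex (x + d) y"
    by (simp add: x_def y_def d_def complex_eq_iff of_rat_diff)
  have cnj_z: "cnj (Complex x y) = cnj \<sigma> + of_real (of_rat b)"
    "cnj (Complex (x + d) y) = cnj \<sigma> + of_real (of_rat a)"
    unfolding za[symmetric] zb[symmetric] by simp_all
  have b': "Complex x y = k * cnj (Complex x y)"
    unfolding cnj_z by (simp only: zb[symmetric] b)
  have a': "Complex (x + d) y = m * cnj (Complex (x + d) y)"
    unfolding cnj_z by (simp only: za[symmetric] a)
  have "(Complex x y)\<^sup>2 = k\<^sup>2 * (cnj (Complex x y))\<^sup>2" by (subst b') (simp add: power_mult_distrib)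
  then have "(Complex x y)\<^sup>2 + (cnj (Complex x y))\<^sup>2 = 0" unfolding k by simp
  from arg_cong[OF this, of Re] have "x\<^sup>2 = y\<^sup>2" by (simp add: power2_eq_square)
  then have "y = 1 * x \<or> y = - 1 * x" by (auto simp: power2_eq_iff)
  then obtain \<epsilon> where \<epsilon>: "\<epsilon> = 1 \<or> \<epsilon> = - (1::real)" "y = \<epsilon> * x" by blast
  define X z where "X = x + d" and "z = Complex X y"
  have z: "z = m * cnj z" using a' by (simp add: z_def X_def)
  have "(z\<^sup>2)\<^sup>2 + z\<^sup>2 * (cnj z)\<^sup>2 + ((cnj z)\<^sup>2)\<^sup>2 = (m ^ 4 + m\<^sup>2 + 1) * cnj z ^ 4"
    by (subst (1 2) z) (simp add: power_mult_distrib algebra_simps eval_nat_numeral)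
  then have "(z\<^sup>2)\<^sup>2 + z\<^sup>2 * (cnj z)\<^sup>2 + ((cnj z)\<^sup>2)\<^sup>2 = 0" unfolding m by simp
  \<comment> \<open>The left side is the real number
    \<open>3 X^4 - 10 X^2 y^2 + 3 y^4\<close>.\<close>
  from arg_cong[OF this, of Re] have "(X\<^sup>2 - 3 * y\<^sup>2) * (3 * X\<^sup>2 - y\<^sup>2) = 0"
    by (simp add: z_def power2_eq_square algebra_simps)
  then have "X\<^sup>2 = 3 * x\<^sup>2 \<or> X\<^sup>2 = x\<^sup>2 / 3" using \<open>x\<^sup>2 = y\<^sup>2\<close> by auto
  then have "X\<^sup>2 = (sqrt 3 * x)\<^sup>2 \<or> X\<^sup>2 = (sqrt 3 / 3 * x)\<^sup>2"
    by (simp add: power_mult_distrib power_divide)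
  then obtain t where t: "t = sqrt 3 \<or> t = - sqrt 3 \<or> t = sqrt 3 / 3 \<or> t = - sqrt 3 / 3" "X = t * x"
    unfolding power2_eq_iff by (metis minus_mult_left minus_divide_left)
  have xd: "x * (t - 1) = d" using t(2) by (simp add: X_def algebra_simps)
  then have "t \<noteq> 1" using d by auto
  define w where "w = Complex (1 / (t - 1)) (\<epsilon> / (t - 1))"
  have "x = d / (t - 1)" using xd \<open>t \<noteq> 1\<close> by (simp add: field_simps)
  then have "\<sigma> + of_real (of_rat b) = of_real d * w"
    unfolding zb \<epsilon>(2) by (simp add: w_def complex_eq_iff)
  then have "\<sigma> = of_real (of_rat (a - b)) * w + of_real (of_rat (- b))"
    by (simp add: d_def of_rat_minus algebra_simps)
  moreover have "Im w \<noteq> 0" using \<epsilon>(1) \<open>t \<noteq> 1\<close> by (auto simp: w_def)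
  ultimately have "homothetic (qspan2 1 \<sigma>) (qspan2 1 w)"
    using ab by (intro homothetic_moebius[where p = "a - b" and q = "- b" and r = 0 and s = 1]) auto
  then show ?thesis using dodecagonal_cases[OF \<epsilon>(1) t(1) w_def] homothetic_trans by blast
qed

section \<open>Spaces with four rational directions\<close>

text \<open>If the coordinate determinant of \<open>t0\<close>, \<open>t1\<close> vanished, then
  \<open>r * t1 = p * t0\<close> and \<open>s * t1 = q * t0\<close>. As \<open>t1 / t0\<close> is
  not real, this forces \<open>r = s = 0\<close> and so \<open>t0 = 0\<close>.\<close>

lemma qspan2_eq_scaled:
  assumes t: "t0 \<in> qspan2 a b" "t1 \<in> qspan2 a b" and t0: "t0 \<noteq> 0" and im: "Im (t1 / t0) \<noteq> 0"
  shows "qspan2 a b = (*) t0 ` qspan2 1 (t1 / t0)"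
proof -
  obtain s r q p where e0: "t0 = of_real (of_rat s) * a + of_real (of_rat r) * b"
    and e1: "t1 = of_real (of_rat q) * a + of_real (of_rat p) * b"
    using t unfolding qspan2_def by auto
  have "p * s - q * r \<noteq> 0"
  proof
    assume D: "p * s - q * r = 0"
    let ?R = "\<lambda>x::rat. complex_of_real (of_rat x)"
    have D': "?R p * ?R s = ?R q * ?R r"
      using D by (simp flip: of_rat_mult of_real_mult)
    have zero: "x = 0" if "?R x * t1 = ?R y * t0" for x y
    proof -
      define u where "u = t1 / t0"
      have "?R x * u = ?R y" using that t0 by (simp add: u_def field_simps)
      from arg_cong[OF this, of Im] have "x = 0 \<or> Im u = 0" by simp
      then show ?thesis using im unfolding u_def by blast
    qed
    have "?R r * t1 = ?R p * t0" unfolding e0 e1 using D' by algebra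
    then have "r = 0" by (rule zero)
    moreover have "?R s * t1 = ?R q * t0" unfolding e0 e1 using D' by algebra
    then have "s = 0" by (rule zero)
    ultimately show False using t0 e0 by simp
  qed
  then show ?thesis
    using t0 e0 e1 by (intro qspan2_change_basis[where p = p and q = q and r = r and s = s]) auto
qed

lemma three_term:
  fixes p q r :: "'a :: comm_ring"
  shows "(p * q * r) * (a * x + b * y + c * z)
    = p * x * (a * (q * r)) + q * y * (b * (r * p)) + r * z * (c * (p * q))"
  by (simp add: algebra_simps)

lemma three_directions:
  fixes a :: "nat \<Rightarrow> rat"
  assumes im: "Im \<sigma> \<noteq> 0" and inj: "inj_on a {0,1,2}"
    and n: "n > 0" and root: "\<And>i. i \<in> {0,1,2} \<Longrightarrow> m i ^ n = 1"
    and m: "\<And>i. i \<in> {0,1,2} \<Longrightarrow> \<sigma> + of_real (of_rat (a i)) = m i * (cnj \<sigma> + of_real (of_rat (a i)))"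
  shows "(\<exists>W. superrectangular W \<and> homothetic (qspan2 1 \<sigma>) W)
     \<or> homothetic (qspan2 1 \<sigma>) (qspan2 1 tau1) \<or> homothetic (qspan2 1 \<sigma>) (qspan2 1 tau2)"
proof -
  define A where "A = (\<lambda>i. complex_of_real (of_rat (a i)))"
  define \<delta> where "\<delta> = cnj \<sigma> - \<sigma>"
  let ?I = "{0, 1, 2} :: nat set"
  have \<delta>: "\<delta> \<noteq> 0" using im by (auto simp: \<delta>_def complex_eq_iff)
  have mA: "\<sigma> + A i = m i * (cnj \<sigma> + A i)" if "i \<in> ?I" for i using m[OF that] by (simp add: A_def)
  have m1: "m i \<noteq> 1" if "i \<in> ?I" for i using mA[OF that] \<delta> by (auto simp: \<delta>_def)
  \<comment> \<open>\<open>A i\<close> is the image of \<open>m i\<close> under the Moebius map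
    \<open>m \<mapsto> (m * cnj \<sigma> - \<sigma>) / (1 - m)\<close>.\<close>
  have diff: "(A i - A j) * ((1 - m i) * (1 - m j)) = (m i - m j) * \<delta>" if "i \<in> ?I" "j \<in> ?I" for i j
    using mA[OF that(1)] mA[OF that(2)] unfolding \<delta>_def by algebra
  have Aneq: "A i \<noteq> A j" if "i \<in> ?I" "j \<in> ?I" "i \<noteq> j" for i j
    using inj that by (auto simp: A_def inj_on_def)
  have mneq: "m i \<noteq> m j" if "i \<in> ?I" "j \<in> ?I" "i \<noteq> j" for i j
    using diff[OF that(1,2)] Aneq[OF that] m1[OF that(1)] m1[OF that(2)] by auto
  \<comment> \<open>Dividing by this root is what produces cosines:
    \<open>m j * m k = s^2 / m i = s * cnj (\<xi> i)\<close>, so \<open>m i + m j * m k\<close> is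
    \<open>s\<close> times a real number. The square root doubles the exponent to
    \<open>2 * n\<close>.\<close>
  define s where "s = csqrt (m 0 * m 1 * m 2)"
  have s2: "s\<^sup>2 = m 0 * m 1 * m 2" by (simp add: s_def)
  have sn: "s ^ (2 * n) = 1"
    using root[of 0] root[of 1] root[of 2] by (simp add: power_mult s2 power_mult_distrib)
  have n2: "2 * n > 0" using n by simp
  have norm_s: "norm s = 1" using root_of_unity_norm[OF sn n2] .
  then have s0: "s \<noteq> 0" by auto
  have norm_m: "norm (m i) = 1" if "i \<in> ?I" for i using root_of_unity_norm[OF root[OF that] n] .
  define \<xi> where "\<xi> = (\<lambda>i. m i / s)"
  have norm_\<xi>: "norm (\<xi> i) = 1" if "i \<in> ?I" for i using norm_m[OF that] norm_s by (simp add: \<xi>_def norm_divide)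
  have m_\<xi>: "m i = s * \<xi> i" for i using s0 by (simp add: \<xi>_def)
  have \<xi>n: "\<xi> i ^ (2 * n) = 1" if "i \<in> ?I" for i
    using root[OF that] sn by (simp add: \<xi>_def power_divide) (simp add: mult.commute power_mult)
  have prod: "\<xi> i * \<xi> j * m k = 1" if "{i, j, k} = ?I" for i j k
  proof -
    have "distinct [i, j, k]"
    proof (rule card_distinct)
      show "card (set [i, j, k]) = length [i, j, k]" using that by simp
    qed
    then have "m i * m j * m k = (\<Prod>l\<in>{i, j, k}. m l)" by (simp add: mult.assoc)
    also have "\<dots> = s\<^sup>2" unfolding that s2 by (simp add: mult.assoc)
    finally show ?thesis using s0 by (simp add: \<xi>_def power2_eq_square)
  qed
  have third: "\<exists>k. {i, j, k} = ?I" if "i \<in> ?I" "j \<in> ?I" "i \<noteq> j" for i j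
    using that by (intro exI[of _ "3 - i - j"]) auto
  define c where "c = (\<lambda>i::nat. of_rat (if i = 0 then a 1 - a 2 else if i = 1 then a 2 - a 0 else a 0 - a 1) :: real)"
  have c: "complex_of_real (c 0) = A 1 - A 2" "complex_of_real (c 1) = A 2 - A 0" "complex_of_real (c 2) = A 0 - A 1"
    by (simp_all add: c_def A_def of_rat_diff)
  \<comment> \<open>Clearing the denominators of the Moebius map turns each difference of the
    \<open>A i\<close> into one of the \<open>m i\<close>, leaving a cyclic identity in
    \<open>m 0\<close>, \<open>m 1\<close>, \<open>m 2\<close>.\<close>
  have "((1 - m 0) * (1 - m 1) * (1 - m 2)) *
      ((A 1 - A 2) * (m 0 + m 1 * m 2) + (A 2 - A 0) * (m 1 + m 2 * m 0) + (A 0 - A 1) * (m 2 + m 0 * m 1))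
    = (1 - m 0) * (m 0 + m 1 * m 2) * ((A 1 - A 2) * ((1 - m 1) * (1 - m 2)))
     + (1 - m 1) * (m 1 + m 2 * m 0) * ((A 2 - A 0) * ((1 - m 2) * (1 - m 0)))
     + (1 - m 2) * (m 2 + m 0 * m 1) * ((A 0 - A 1) * ((1 - m 0) * (1 - m 1)))"
    by (rule three_term)
  also have "\<dots> = 0"
    by (simp add: diff) (simp add: algebra_simps)
  finally have "(A 1 - A 2) * (m 0 + m 1 * m 2) + (A 2 - A 0) * (m 1 + m 2 * m 0) + (A 0 - A 1) * (m 2 + m 0 * m 1) = 0"
    using m1 by simp
  note sum0 = this
  have key: "m i + m j * m k = s * of_real (2 * Re (\<xi> i))" if "{i, j, k} = ?I" for i j k
  proof -
    have i: "i \<in> ?I" unfolding that[symmetric] by simp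
    have "{j, k, i} = {i, j, k}" by blast
    from prod[OF this[unfolded that]] have 1: "\<xi> j * \<xi> k * s * \<xi> i = 1" by (simp add: m_\<xi> mult.assoc)
    have "cnj (\<xi> i) = (\<xi> j * \<xi> k * s * \<xi> i) * cnj (\<xi> i)" by (simp only: 1 mult_1)
    also have "\<dots> = \<xi> j * \<xi> k * s * (\<xi> i * cnj (\<xi> i))" by (simp only: mult.assoc)
    finally have 2: "cnj (\<xi> i) = \<xi> j * \<xi> k * s"
      unfolding unit_mult_cnj(1)[OF norm_\<xi>[OF i]] by simp
    have "m i + m j * m k = s * (\<xi> i + cnj (\<xi> i))" unfolding 2 by (simp add: m_\<xi> algebra_simps)
    then show ?thesis unfolding complex_add_cnj .
  qed
  have "{1, 2, 0} = ?I" "{2, 0, 1} = ?I" by blast+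
  note keys = key[OF refl] key[OF this(1)] key[OF this(2)]
  from sum0 have "complex_of_real (c 0) * (s * of_real (2 * Re (\<xi> 0))) + of_real (c 1) * (s * of_real (2 * Re (\<xi> 1)))
      + of_real (c 2) * (s * of_real (2 * Re (\<xi> 2))) = 0"
    unfolding keys by (simp only: c)
  then have "2 * s * complex_of_real (c 0 * Re (\<xi> 0) + c 1 * Re (\<xi> 1) + c 2 * Re (\<xi> 2)) = 0"
    by (simp add: algebra_simps)
  then have rel: "c 0 * Re (\<xi> 0) + c 1 * Re (\<xi> 1) + c 2 * Re (\<xi> 2) = 0"
    using s0 by (simp only: mult_eq_0_iff of_real_eq_0_iff) simp
  \<comment> \<open>Equal cosines would mean \<open>m i = m j\<close>, or
    \<open>\<xi> i * \<xi> j = 1\<close> and hence \<open>m k = 1\<close> for the third index, which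
    would make \<open>\<sigma>\<close> real.\<close>
  have Re_inj: "Re (\<xi> i) \<noteq> Re (\<xi> j)" if ij: "i \<in> ?I" "j \<in> ?I" "i \<noteq> j" for i j
  proof
    assume "Re (\<xi> i) = Re (\<xi> j)"
    then consider "\<xi> i = \<xi> j" | "\<xi> i = cnj (\<xi> j)" using unit_Re_eq norm_\<xi> ij by blast
    then show False
    proof cases
      case 1
      then show False using mneq[OF ij] s0 by (simp add: \<xi>_def)
    next
      case 2
      obtain k where k: "{i, j, k} = ?I" using third[OF ij] by blast
      have "\<xi> i * \<xi> j = 1" using 2 unit_mult_cnj(2) norm_\<xi> ij by simp
      then have "m k = 1" using prod[OF k] by simp
      then show False using m1[of k] unfolding k[symmetric] by simp
    qed
  qed
  have c_nz: "c i \<noteq> 0" if "i \<in> ?I" for i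
  proof -
    have "complex_of_real (c i) \<noteq> 0" using that c Aneq[of 1 2] Aneq[of 2 0] Aneq[of 0 1] by auto
    then show ?thesis by simp
  qed
  have c_sum: "c 0 + c 1 + c 2 = 0"
  proof -
    have "complex_of_real (c 0 + c 1 + c 2) = 0" unfolding of_real_add c by simp
    then show ?thesis by (simp only: of_real_eq_0_iff)
  qed
  show ?thesis
  proof (rule cosine_dichotomy[of ?I c \<xi> "2 * n"])
    show "inj_on (\<lambda>i. Re (\<xi> i)) ?I" using Re_inj by (meson inj_onI)
    show "(\<Sum>i\<in>?I. c i) = 0" using c_sum by (simp add: add.assoc)
    show "(\<Sum>i\<in>?I. c i * Re (\<xi> i)) = 0" using rel by (simp add: add.assoc)
  next
    fix i j assume ij: "i \<in> ?I" "j \<in> ?I" "i \<noteq> j" and "Re (\<xi> i) = - Re (\<xi> j)"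
    then have "Re (\<xi> i) = Re (- \<xi> j)" by simp
    \<comment> \<open>In the first case the vectors of \<open>i\<close> and \<open>j\<close> are
      orthogonal; in the second \<open>m k = - 1\<close>, so the vector of the third index is
      orthogonal to 1.\<close>
    then consider "\<xi> i = - \<xi> j" | "\<xi> i = cnj (- \<xi> j)"
      using unit_Re_eq[of "\<xi> i" "- \<xi> j"] norm_\<xi> ij by auto
    then have "\<exists>W. superrectangular W \<and> homothetic (qspan2 1 \<sigma>) W"
    proof cases
      case 1
      then have "m j = - m i" using m_\<xi>[of i] m_\<xi>[of j] by simp
      then show ?thesis
        using superrectangular_opposite_directions[OF im _ n root[OF ij(1)] m[OF ij(1)], of "a j"]
          m[OF ij(2)] inj ij by (metis inj_onD)
    next
      case 2
      obtain k where k: "{i, j, k} = ?I" using third[OF ij] by blast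
      have kI: "k \<in> ?I" unfolding k[symmetric] by simp
      have "k \<noteq> i"
      proof
        assume "k = i"
        then have "card {i, j} = card ?I" unfolding k[symmetric] by (simp add: insert_commute)
        then show False using ij(3) by simp
      qed
      have "\<xi> i * \<xi> j = - 1" using 2 unit_mult_cnj(2)[OF norm_\<xi>[OF ij(2)]] by simp
      then have "m k = - 1" using prod[OF k] by (metis minus_minus mult_minus1)
      then show ?thesis
        using superrectangular_imaginary_direction[OF im _ n root[OF ij(1)] m[OF ij(1)], of "a k"]
          m[OF kI] inj ij(1) kI \<open>k \<noteq> i\<close> by (metis inj_onD mult_minus1)
    qed
    then show ?thesis ..
  next
    assume vals: "(\<lambda>i. \<bar>Re (\<xi> i)\<bar>) ` ?I = {0, 1/2, 1}"
    have "1 \<in> (\<lambda>i. \<bar>Re (\<xi> i)\<bar>) ` ?I" "1/2 \<in> (\<lambda>i. \<bar>Re (\<xi> i)\<bar>) ` ?I" "0 \<in> (\<lambda>i. \<bar>Re (\<xi> i)\<bar>) ` ?I"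
      unfolding vals by simp_all
    then obtain i j k where i: "i \<in> ?I" "\<bar>Re (\<xi> i)\<bar> = 1" and j: "j \<in> ?I" "\<bar>Re (\<xi> j)\<bar> = 1/2"
      and k: "k \<in> ?I" "\<bar>Re (\<xi> k)\<bar> = 0"
      by (elim imageE) metis
    have neq: "i \<noteq> j" "j \<noteq> k" "i \<noteq> k" using i j k by auto
    have ijk: "{i, j, k} = ?I" "{i, k, j} = ?I"
      using i(1) j(1) k(1) neq by auto
    have sq: "(Re (\<xi> l))\<^sup>2 + (Im (\<xi> l))\<^sup>2 = 1" if "l \<in> ?I" for l
      using norm_\<xi>[OF that] by (simp add: cmod_def)
    have xi_i: "(\<xi> i)\<^sup>2 = 1"
    proof -
      have "(Re (\<xi> i))\<^sup>2 = 1" using i(2) by (metis power2_abs power_one)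
      moreover then have "Im (\<xi> i) = 0" using sq[OF i(1)] by simp
      ultimately show ?thesis by (simp add: complex_eq_iff power2_eq_square)
    qed
    have xi_k: "(\<xi> k)\<^sup>2 = - 1"
    proof -
      have "Re (\<xi> k) = 0" using k(2) by simp
      moreover then have "(Im (\<xi> k))\<^sup>2 = 1" using sq[OF k(1)] by simp
      ultimately show ?thesis by (simp add: complex_eq_iff power2_eq_square)
    qed
    have xi_j: "(\<xi> j) ^ 4 + (\<xi> j)\<^sup>2 + 1 = 0"
    proof -
      define x y where "x = Re (\<xi> j)" and "y = Im (\<xi> j)"
      have "x = 1/2 \<or> x = - (1/2)" using j(2) unfolding x_def by linarith
      then have x: "x\<^sup>2 = 1/4" by (elim disjE) (simp_all only: power2_minus power_divide, simp_all)
      then have y: "y\<^sup>2 = 3/4" using sq[OF j(1)] by (simp add: x_def y_def)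
      have sqj: "(\<xi> j)\<^sup>2 = Complex (-1/2) (2 * x * y)"
        using x y by (simp add: complex_eq_iff x_def y_def power2_eq_square)
      have "(\<xi> j) ^ 4 = (\<xi> j)\<^sup>2 * (\<xi> j)\<^sup>2" by (simp flip: power_add)
      also have "\<dots> = Complex (1/4 - 4 * (x\<^sup>2 * y\<^sup>2)) (- 2 * x * y)"
        unfolding sqj by (simp add: complex_eq_iff power2_eq_square)
      finally show ?thesis using x y unfolding sqj by (simp add: complex_eq_iff)
    qed
    \<comment> \<open>The roles of \<open>j\<close> and \<open>k\<close> are exchanged on passing
      from \<open>\<xi>\<close> to \<open>m\<close>: the inverse square of \<open>\<xi> j\<close> is
      the square of \<open>m k\<close>, while \<open>m j\<close> is a square root of -1.\<close>
    have "(\<xi> i)\<^sup>2 * (\<xi> j)\<^sup>2 * (m k)\<^sup>2 = 1" using prod[OF ijk(1)] by (metis power_mult_distrib power_one)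
    then have mk: "(\<xi> j)\<^sup>2 * (m k)\<^sup>2 = 1" by (simp add: xi_i)
    have "(\<xi> i)\<^sup>2 * (\<xi> k)\<^sup>2 * (m j)\<^sup>2 = 1" using prod[OF ijk(2)] by (metis power_mult_distrib power_one)
    then have "(m j)\<^sup>2 = - 1" by (simp add: xi_i xi_k minus_equation_iff)
    moreover have "m k ^ 4 + (m k)\<^sup>2 + 1 = 0"
    proof -
      have "(m k ^ 4 + (m k)\<^sup>2 + 1) * 1 = m k ^ 4 * (\<xi> j ^ 4 + (\<xi> j)\<^sup>2 + 1)"
        using mk by algebra
      then show ?thesis using xi_j by simp
    qed
    moreover have "a k \<noteq> a j" using inj j(1) k(1) neq by (metis inj_onD)
    ultimately show ?thesis
      using dodecagonal[OF im _ m[OF k(1)] _ m[OF j(1)]] by blast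
  qed (use c_nz \<xi>n n in \<open>auto simp: c_def\<close>)
qed

section \<open>Normalising a rational 4-tuple\<close>

lemma real_lines_equal:
  assumes "Im (v / u) = 0" "u \<noteq> 0" "v \<noteq> 0"
  shows "{of_real t * v | t. True} = {of_real t * u | t. True}"
proof -
  define r where "r = Re (v / u)"
  have "v / u = of_real r" using assms(1) by (simp add: r_def complex_eq_iff)
  then have v: "v = of_real r * u" and "r \<noteq> 0" using assms by (auto simp: field_simps)
  have "of_real t * v = of_real (t * r) * u" "of_real t * u = of_real (t / r) * v" for t
    using \<open>r \<noteq> 0\<close> by (simp_all add: v)
  then show ?thesis by blast
qed

text \<open>The coefficient \<open>y\<close> of \<open>\<sigma>\<close> is nonzero because
  \<open>t / t0\<close> is not real. Dividing by it leaves \<open>\<sigma> + a\<close>, and a real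
  factor does not change the quotient of a vector by its conjugate.\<close>

lemma rational_direction:
  assumes t: "t / t0 \<in> qspan2 1 \<sigma>" "Im (t / t0) \<noteq> 0" and arg: "Arg (t / t0) = of_rat r * pi"
  shows "\<exists>a y m n. y \<noteq> 0 \<and> t / t0 = of_real y * (\<sigma> + of_real (of_rat a)) \<and> n > 0 \<and> m ^ n = 1
    \<and> \<sigma> + of_real (of_rat a) = m * (cnj \<sigma> + of_real (of_rat a))"
proof -
  define u where "u = t / t0"
  obtain x y where u: "u = of_real (of_rat x) + of_real (of_rat y) * \<sigma>"
    using t(1) by (auto simp: qspan2_def u_def)
  have im: "Im u \<noteq> 0" using t(2) unfolding u_def .
  have y: "y \<noteq> 0" using im by (auto simp: u)
  have u0: "u \<noteq> 0" using im by auto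
  define Y where "Y = (of_rat y :: real)"
  have Y: "Y \<noteq> 0" using y by (simp add: Y_def)
  have uY: "u = of_real Y * (\<sigma> + of_real (of_rat (x / y)))"
    using y by (simp add: u Y_def of_rat_divide algebra_simps)
  have cnj_uY: "cnj u = of_real Y * (cnj \<sigma> + of_real (of_rat (x / y)))"
    by (simp add: uY)
  obtain n where n: "n > 0" "(u / cnj u) ^ n = 1"
    using direction_root_of_unity[of u r] arg u0 unfolding u_def by blast
  have "u = (u / cnj u) * cnj u" using u0 by simp
  then have "of_real Y * (\<sigma> + of_real (of_rat (x / y)))
      = of_real Y * ((u / cnj u) * (cnj \<sigma> + of_real (of_rat (x / y))))"
    unfolding cnj_uY uY[symmetric] by (simp only: mult.left_commute)
  then have "\<sigma> + of_real (of_rat (x / y)) = (u / cnj u) * (cnj \<sigma> + of_real (of_rat (x / y)))"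
    using Y by (simp only: mult_cancel_left of_real_eq_0_iff) blast
  then show ?thesis using n Y uY unfolding u_def by blast
qed

theorem theorem7p3:
  fixes V :: "complex set"
  assumes "is_space V"
    and "\<exists>T. rational_4tuple V T"
  shows "(\<exists>W. superrectangular W \<and> homothetic V W)
       \<or> homothetic V (qspan2 1 tau1) \<or> homothetic V (qspan2 1 tau2)"
proof -
  obtain T where T: "rational_4tuple V T" using assms(2) by blast
  obtain a b where V: "V = qspan2 a b" using assms(1) by (auto simp: is_space_def)
  have sub: "T \<subseteq> V" and card: "card T = 4" and zero: "0 \<notin> T"
    and lines: "card ((\<lambda>v. {of_real t * v | t. True}) ` T) = card T"
    and args: "\<And>v w. v \<in> T \<Longrightarrow> w \<in> T \<Longrightarrow> \<exists>r::rat. Arg (w / v) = of_rat r * pi"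
    using T by (auto simp: rational_4tuple_def)
  have fin: "finite T" using card by (metis card.infinite zero_neq_numeral)
  obtain ts where ts: "set ts = T" "distinct ts" using finite_distinct_list[OF fin] by blast
  then have "length ts = 4" using card by (metis distinct_card)
  then obtain t0 t1 t2 t3 where "ts = [t0, t1, t2, t3]"
    by (auto simp: numeral_eq_Suc length_Suc_conv)
  then have T: "T = {t0, t1, t2, t3}" and dist: "distinct [t0, t1, t2, t3]" using ts by auto
  have inj: "inj_on (\<lambda>v. {of_real t * v | t. True}) T"
    using fin lines by (rule eq_card_imp_inj_on)
  have Im: "Im (v / u) \<noteq> 0" if "u \<in> T" "v \<in> T" "u \<noteq> v" for u v
    using inj_onD[OF inj, of v u] real_lines_equal[of v u] zero that by metis
  define \<sigma> where "\<sigma> = t1 / t0"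
  have t0: "t0 \<noteq> 0" "t0 \<in> T" "t1 \<in> T" "t0 \<noteq> t1" using zero T dist by auto
  have im: "Im \<sigma> \<noteq> 0" unfolding \<sigma>_def using Im t0 by blast
  have V': "V = (*) t0 ` qspan2 1 \<sigma>"
    unfolding V \<sigma>_def using t0 sub im by (intro qspan2_eq_scaled) (auto simp: V \<sigma>_def)
  then have hom: "homothetic V (qspan2 1 \<sigma>)"
    using t0(1) by (intro homothetic_sym[of "qspan2 1 \<sigma>"]) (auto simp: homothetic_def)
  define P where "P = (\<lambda>t a y m n. y \<noteq> 0 \<and> t / t0 = of_real y * (\<sigma> + of_real (of_rat a)) \<and> n > (0::nat) \<and> m ^ n = 1
    \<and> \<sigma> + of_real (of_rat a) = m * (cnj \<sigma> + of_real (of_rat a)))"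
  have "\<exists>a y m n. P t a y m n" if "t \<in> {t1, t2, t3}" for t
  proof -
    have t: "t \<in> T" "t0 \<noteq> t" using that T dist by auto
    then obtain r :: rat where "Arg (t / t0) = of_rat r * pi" using args t0(2) by blast
    moreover have "t / t0 \<in> qspan2 1 \<sigma>" using t(1) sub t0(1) unfolding V' by auto
    ultimately show ?thesis
      using rational_direction Im[OF t0(2) t] unfolding P_def by blast
  qed
  then obtain a y m n where P: "\<And>t. t \<in> {t1, t2, t3} \<Longrightarrow> P t (a t) (y t) (m t) (n t)" by metis
  note t = P[unfolded P_def]
  \<comment> \<open>Equal shifts would make \<open>t\<close> and \<open>u\<close> real multiples of
    one vector, hence span the same line.\<close>
  have a_neq: "a t \<noteq> a u" if tu: "t \<in> {t1, t2, t3}" "u \<in> {t1, t2, t3}" "t \<noteq> u" for t u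
  proof
    assume eq: "a t = a u"
    have T': "t \<in> T" "u \<in> T" using tu T by auto
    define w where "w = \<sigma> + of_real (of_rat (a u))"
    have "t / t0 = of_real (y t) * w" "u / t0 = of_real (y u) * w"
      using t[OF tu(1)] t[OF tu(2)] unfolding eq w_def by blast+
    then have "t = of_real (y t) * (t0 * w)" "u = of_real (y u) * (t0 * w)"
      using t0(1) by (simp_all add: field_simps)
    moreover have "t \<noteq> 0" using T' zero by auto
    ultimately have "u / t = of_real (y u / y t)" by (metis mult_divide_mult_cancel_right mult_zero_right of_real_divide)
    then show False using Im[OF T' tu(3)] by simp
  qed
  define s where "s = (!) [t1, t2, t3]"
  have s: "s i \<in> {t1, t2, t3}" if "i \<in> {0, 1, 2}" for i using that by (auto simp: s_def)
  have s_inj: "inj_on s {0, 1, 2}" using dist by (auto simp: s_def inj_on_def)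
  \<comment> \<open>A common exponent for the three roots of unity.\<close>
  define N where "N = n t1 * n t2 * n t3"
  have N: "n t dvd N" if "t \<in> {t1, t2, t3}" for t using that by (auto simp: N_def)
  have "(\<exists>W. superrectangular W \<and> homothetic (qspan2 1 \<sigma>) W)
     \<or> homothetic (qspan2 1 \<sigma>) (qspan2 1 tau1) \<or> homothetic (qspan2 1 \<sigma>) (qspan2 1 tau2)"
  proof (rule three_directions[OF im, of "\<lambda>i. a (s i)" N "\<lambda>i. m (s i)"])
    show "inj_on (\<lambda>i. a (s i)) {0, 1, 2}"
      using a_neq s s_inj unfolding inj_on_def by metis
    show "N > 0" using t by (simp add: N_def)
    fix i :: nat assume "i \<in> {0, 1, 2}"
    note ti = t[OF s[OF this]] and Ni = N[OF s[OF this]]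
    show "m (s i) ^ N = 1" using ti Ni by (metis dvd_def power_mult power_one)
    show "\<sigma> + of_real (of_rat (a (s i))) = m (s i) * (cnj \<sigma> + of_real (of_rat (a (s i))))"
      using ti by blast
  qed
  then show ?thesis using hom homothetic_trans by blast
qed

end
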